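(* Let $K\subseteq\overline{\Omega}$ be a smooth compact set, let $n\ge 1$ and let $\zeta\colon C^{\ell,\alpha}(K)\to C^{0,\alpha}(K)^n$ be a continuous linear map. Assume that the candidate set satisfies $\mathcal{C}(K)=K$. Then the admissible set $\mathcal{E}(K)$ is open and dense in $\mathcal{H}(K)^{\left[\frac{d+n}{\alpha}\right]}$.
   Context: Setting. $\Omega\subseteq\mathbb{R}^d$, $d\ge2$, is a bounded smooth domain. Consider the second-order operator $$Lu:=-\operatorname{div}(a\nabla u+bu)+c\cdot\nabla u+qu,$$ with real coefficients, where $Lu=0$ in $\Omega$ is understood in the weak sense for $u\in H^1(\Omega)=H^1(\Omega;\mathbb{R})$. $L$ is uniformly elliptic: there is $\lambda>0$ with $a(x)\xi\cdot\xi\ge\lambda|\xi|^2$ for a.e. $x\in\Omega$ and all $\xi\in\mathbb{R}^d$. The coefficients satisfy one of the following: (i) for some integer $\ell\ge1$ and some $\alpha\in(0,1)$: $a\in C^{\ell-1,\alpha}(\overline\Omega;\mathbb{R}^{d\times d})$, $b\in C^{\ell-1,\alpha}(\overline\Omega;\mathbb{R}^d)$, $c\in W^{\ell-1,\infty}(\Omega;\mathbb{R}^d)$, $q\in W^{\ell-1,\infty}(\Omega;\mathbb{R})$; (ii) ($\ell=0$): $a\in L^\infty(\Omega;\mathbb{R}^{d\times d})$, $b,c\in L^\infty(\Omega;\mathbb{R}^d)$, $q\in L^\infty(\Omega;\mathbb{R})$; in this case $\alpha\in(0,1)$ is a Hölder exponent for which weak solutions of $Lu=0$ are in $C^{0,\alpha}_{\mathrm{loc}}(\Omega)$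 (and in $C^{0,\alpha}(\overline\Omega)$ for boundary data in a suitable trace space), for example the one given by the De Giorgi–Nash–Moser theorem. Notation. Function spaces are real-valued. For a smooth compact set $K\subseteq\overline\Omega$, $$\mathcal{H}(K)=\{u\in C^{\ell,\alpha}(K)\cap H^1(\Omega): Lu=0\text{ in }\Omega\},\qquad \|u\|_{\mathcal{H}(K)}=\|u\|_{C^{\ell,\alpha}(K)}+\|u\|_{H^1(\Omega)}.$$ For $u\in\mathcal{H}(K)$, $\zeta(u)$ denotes $\zeta$ applied to $u$ on $K$, and $\zeta(u)(x)\in\mathbb{R}^n$ is regarded as a row vector; for $u_1,\dots,u_m\in\mathcal H(K)$, $\begin{bmatrix}\zeta(u_1)\\ \vdots\\ \zeta(u_m)\end{bmatrix}(x)$ is the $m\times n$ matrix with rows $\zeta(u_i)(x)$. $\left[\frac{d+n}{\alpha}\right]$ is the integer part of $\frac{d+n}{\alpha}$, i.e. the largest integer not exceeding it. The candidate set $\mathcal{C}(K)$ is the set of all $x\in K$ for which there exist $u_1,\dots,u_n\in\mathcal{H}(K)$ such that $\det\begin{bmatrix}\zeta(u_1)\\ \vdots\\ \zeta(u_n)\end{bmatrix}(x)\ne0$. The admissible set $\mathcal{E}(K)$ is the set of all $u=(u_1,\dots,u_{\left[\frac{d+n}{\alpha}\right]})\in\mathcal{H}(K)^{\left[\frac{d+n}{\alpha}\right]}$ such that $$\sum_{i_1,\dots,i_n=1}^{\left[\frac{d+n}{\alpha}\right]}\left|\det\begin{bmatrix}\zeta(u_{i_1})\\ \vdots\\ \zeta(u_{i_n})\end{bmatrix}(x)\right|>0\quad\text{for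 all }x\in K.$$ *)

theory Defs
  imports "HOL-Analysis.Analysis"
begin

section \<open>Classical derivatives and smooth sets\<close>

text \<open>
  Partial derivatives of order \<open>k\<close> are indexed by words of length \<open>k\<close> over the standard basis
  rather than by multi-indices. For \<open>C\<^sup>k\<close> functions (and for weak derivatives) the order of the
  letters is irrelevant, so a multi-index is merely represented by several words; this only
  changes the multiplicities in the sums defining norms.
\<close>

fun iter_pderiv :: "'a::euclidean_space list \<Rightarrow> ('a \<Rightarrow> 'b::real_normed_vector) \<Rightarrow> 'a \<Rightarrow> 'b" where
  "iter_pderiv [] u = u"
| "iter_pderiv (e # es) u = (\<lambda>x. frechet_derivative (iter_pderiv es u) (at x) e)"

definition gradient :: "('a::euclidean_space \<Rightarrow> real) \<Rightarrow> 'a \<Rightarrow> 'a" where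
  "gradient f x = (\<Sum>e\<in>Basis. iter_pderiv [e] f x *\<^sub>R e)"

definition smooth_on :: "'a::euclidean_space set \<Rightarrow> ('a \<Rightarrow> 'b::real_normed_vector) \<Rightarrow> bool" where
  "smooth_on U f \<longleftrightarrow>
     (\<forall>es. set es \<subseteq> Basis \<longrightarrow> (\<forall>x\<in>U. iter_pderiv es f differentiable (at x)))"

text \<open>
  A smooth boundary is described by local defining functions. In particular the set lies locally
  on one side of its boundary.
\<close>

definition has_smooth_boundary :: "'a::euclidean_space set \<Rightarrow> bool" where
  "has_smooth_boundary D \<longleftrightarrow>
     (\<forall>p\<in>frontier D. \<exists>V (\<phi> :: 'a \<Rightarrow> real). open V \<and> p \<in> V \<and> smooth_on V \<phi> \<and>
        (\<forall>x\<in>V. gradient \<phi> x \<noteq> 0) \<and> D \<inter> V = {x\<in>V. \<phi> x < 0})"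

definition bounded_smooth_domain :: "'a::euclidean_space set \<Rightarrow> bool" where
  "bounded_smooth_domain D \<longleftrightarrow>
     open D \<and> connected D \<and> D \<noteq> {} \<and> bounded D \<and> has_smooth_boundary D"

definition smooth_compact :: "'a::euclidean_space set \<Rightarrow> bool" where
  "smooth_compact K \<longleftrightarrow> compact K \<and> (\<exists>D. open D \<and> has_smooth_boundary D \<and> K = closure D)"

section \<open>Hoelder spaces\<close>

text \<open>
  The sup-norm and the Hoelder seminorm are written as least admissible constants, so that they are
  \<open>0\<close> on the empty set.
\<close>

definition sup_norm :: "'a set \<Rightarrow> ('a \<Rightarrow> 'b::real_normed_vector) \<Rightarrow> real" where
  "sup_norm S f = Inf {M. 0 \<le> M \<and> (\<forall>x\<in>S. norm (f x) \<le> M)}"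

definition holder_bound :: "real \<Rightarrow> 'a::metric_space set \<Rightarrow> ('a \<Rightarrow> 'b::real_normed_vector) \<Rightarrow> real \<Rightarrow> bool" where
  "holder_bound \<alpha> S f M \<longleftrightarrow>
     0 \<le> M \<and> (\<forall>x\<in>S. \<forall>y\<in>S. norm (f x - f y) \<le> M * dist x y powr \<alpha>)"

definition holder_seminorm :: "real \<Rightarrow> 'a::metric_space set \<Rightarrow> ('a \<Rightarrow> 'b::real_normed_vector) \<Rightarrow> real" where
  "holder_seminorm \<alpha> S f = Inf {M. holder_bound \<alpha> S f M}"

text \<open>
  \<open>C\<^sup>k\<^sup>,\<^sup>\<alpha>(K)\<close> for a set \<open>K\<close> that is the closure of its interior: the derivatives are taken in the
  interior and extend continuously to \<open>K\<close>. Only the values of \<open>u\<close> on \<open>K\<close> are relevant; a function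
  on \<open>K\<close> is represented by any of its extensions. For \<open>k = 0\<close> the sup-norm and Hoelder seminorm
  over the interior agree with those over \<open>K\<close>, as \<open>u\<close> is continuous on \<open>K\<close>.
\<close>

definition holder_space :: "nat \<Rightarrow> real \<Rightarrow> 'a::euclidean_space set \<Rightarrow> ('a \<Rightarrow> 'b::real_normed_vector) set" where
  "holder_space k \<alpha> K =
     {u. continuous_on K u \<and>
         (\<forall>es. set es \<subseteq> Basis \<and> length es < k \<longrightarrow>
            (\<forall>x\<in>interior K. iter_pderiv es u differentiable (at x))) \<and>
         (\<forall>es. set es \<subseteq> Basis \<and> length es \<le> k \<longrightarrow>
            (\<exists>g. continuous_on K g \<and> (\<forall>x\<in>interior K. g x = iter_pderiv es u x))) \<and>
         (\<forall>es. set es \<subseteq> Basis \<and> length es = k \<longrightarrow>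
            (\<exists>M. holder_bound \<alpha> (interior K) (iter_pderiv es u) M))}"

definition holder_norm :: "nat \<Rightarrow> real \<Rightarrow> 'a::euclidean_space set \<Rightarrow> ('a \<Rightarrow> 'b::real_normed_vector) \<Rightarrow> real" where
  "holder_norm k \<alpha> K u =
     (\<Sum>es | set es \<subseteq> Basis \<and> length es \<le> k. sup_norm (interior K) (iter_pderiv es u)) +
     (\<Sum>es | set es \<subseteq> Basis \<and> length es = k. holder_seminorm \<alpha> (interior K) (iter_pderiv es u))"

section \<open>Lebesgue and Sobolev spaces\<close>

text \<open>
  Elements of these spaces are represented by functions, not by classes modulo null sets.
\<close>

definition L2_space :: "'a::euclidean_space set \<Rightarrow> ('a \<Rightarrow> 'b::euclidean_space) set" where
  "L2_space \<Omega> = {u. u \<in> borel_measurable (lebesgue_on \<Omega>) \<and>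
                    integrable (lebesgue_on \<Omega>) (\<lambda>x. (norm (u x))\<^sup>2)}"

definition Linf_space :: "'a::euclidean_space set \<Rightarrow> ('a \<Rightarrow> 'b::euclidean_space) set" where
  "Linf_space \<Omega> = {u. u \<in> borel_measurable (lebesgue_on \<Omega>) \<and>
                      (\<exists>M. AE x in lebesgue_on \<Omega>. norm (u x) \<le> M)}"

definition test_functions :: "'a::euclidean_space set \<Rightarrow> ('a \<Rightarrow> real) set" where
  "test_functions \<Omega> =
     {\<phi>. smooth_on UNIV \<phi> \<and> (\<exists>C. compact C \<and> C \<subseteq> \<Omega> \<and> (\<forall>x. x \<notin> C \<longrightarrow> \<phi> x = 0))}"

definition locally_integrable :: "'a::euclidean_space set \<Rightarrow> ('a \<Rightarrow> 'b::euclidean_space) \<Rightarrow> bool" where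
  "locally_integrable \<Omega> u \<longleftrightarrow> (\<forall>C. compact C \<and> C \<subseteq> \<Omega> \<longrightarrow> u absolutely_integrable_on C)"

definition weak_pderiv ::
    "'a::euclidean_space set \<Rightarrow> 'a list \<Rightarrow> ('a \<Rightarrow> 'b::euclidean_space) \<Rightarrow> ('a \<Rightarrow> 'b) \<Rightarrow> bool" where
  "weak_pderiv \<Omega> es u g \<longleftrightarrow>
     locally_integrable \<Omega> u \<and> locally_integrable \<Omega> g \<and>
     (\<forall>\<phi>\<in>test_functions \<Omega>.
        (LINT x|lebesgue_on \<Omega>. iter_pderiv es \<phi> x *\<^sub>R u x) =
        (-1) ^ length es *\<^sub>R (LINT x|lebesgue_on \<Omega>. \<phi> x *\<^sub>R g x))"

definition W_inf :: "nat \<Rightarrow> 'a::euclidean_space set \<Rightarrow> ('a \<Rightarrow> 'b::euclidean_space) set" where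
  "W_inf k \<Omega> = {u \<in> Linf_space \<Omega>.
     \<forall>es. set es \<subseteq> Basis \<and> length es \<le> k \<longrightarrow> (\<exists>g\<in>Linf_space \<Omega>. weak_pderiv \<Omega> es u g)}"

definition weak_gradient :: "'a::euclidean_space set \<Rightarrow> ('a \<Rightarrow> real) \<Rightarrow> ('a \<Rightarrow> 'a) \<Rightarrow> bool" where
  "weak_gradient \<Omega> u G \<longleftrightarrow>
     G \<in> L2_space \<Omega> \<and> (\<forall>e\<in>Basis. weak_pderiv \<Omega> [e] u (\<lambda>x. G x \<bullet> e))"

definition H1 :: "'a::euclidean_space set \<Rightarrow> ('a \<Rightarrow> real) set" where
  "H1 \<Omega> = {u \<in> L2_space \<Omega>. \<exists>G. weak_gradient \<Omega> u G}"

text \<open>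
  The weak gradient is unique up to null sets, so the infimum below is over a single number; it
  merely avoids choosing a representative.
\<close>

definition H1_norm :: "'a::euclidean_space set \<Rightarrow> ('a \<Rightarrow> real) \<Rightarrow> real" where
  "H1_norm \<Omega> u =
     (INF G\<in>{G. weak_gradient \<Omega> u G}.
        sqrt ((LINT x|lebesgue_on \<Omega>. (u x)\<^sup>2) + (LINT x|lebesgue_on \<Omega>. (norm (G x))\<^sup>2)))"

definition H1_0 :: "'a::euclidean_space set \<Rightarrow> ('a \<Rightarrow> real) set" where
  "H1_0 \<Omega> = {u \<in> H1 \<Omega>. \<forall>\<epsilon>>0. \<exists>\<phi>\<in>test_functions \<Omega>. H1_norm \<Omega> (\<lambda>x. u x - \<phi> x) < \<epsilon>}"

section \<open>The elliptic operator\<close>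

definition weak_solution ::
    "(real^'d) set \<Rightarrow> (real^'d \<Rightarrow> real^'d^'d) \<Rightarrow> (real^'d \<Rightarrow> real^'d) \<Rightarrow> (real^'d \<Rightarrow> real^'d) \<Rightarrow>
     (real^'d \<Rightarrow> real) \<Rightarrow> (real^'d \<Rightarrow> real) \<Rightarrow> bool" where
  "weak_solution \<Omega> a b c q u \<longleftrightarrow>
     u \<in> H1 \<Omega> \<and>
     (\<exists>G. weak_gradient \<Omega> u G \<and>
        (\<forall>\<phi>\<in>test_functions \<Omega>.
           (LINT x|lebesgue_on \<Omega>.
              (a x *v G x + u x *\<^sub>R b x) \<bullet> gradient \<phi> x + (c x \<bullet> G x) * \<phi> x + q x * u x * \<phi> x) = 0))"

definition uniformly_elliptic :: "(real^'d) set \<Rightarrow> (real^'d \<Rightarrow> real^'d^'d) \<Rightarrow> bool" where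
  "uniformly_elliptic \<Omega> a \<longleftrightarrow>
     (\<exists>m>0. AE x in lebesgue_on \<Omega>. \<forall>\<xi>. (a x *v \<xi>) \<bullet> \<xi> \<ge> m * (norm \<xi>)\<^sup>2)"

text \<open>
  \<open>\<alpha>\<close> is a Hoelder exponent for weak solutions: in the interior, and up to the boundary for
  solutions whose boundary values are those of some \<open>g \<in> T\<close> in the sense of traces. The
  class \<open>T\<close> of boundary data, given by extensions to \<open>\<Omega>\<close>, is a parameter.
\<close>

definition solution_holder_exponent ::
    "(real^'d) set \<Rightarrow> (real^'d \<Rightarrow> real^'d^'d) \<Rightarrow> (real^'d \<Rightarrow> real^'d) \<Rightarrow> (real^'d \<Rightarrow> real^'d) \<Rightarrow>
     (real^'d \<Rightarrow> real) \<Rightarrow> (real^'d \<Rightarrow> real) set \<Rightarrow> real \<Rightarrow> bool" where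
  "solution_holder_exponent \<Omega> a b c q T \<alpha> \<longleftrightarrow>
     (\<forall>u. weak_solution \<Omega> a b c q u \<longrightarrow>
        (\<exists>v. (AE x in lebesgue_on \<Omega>. v x = u x) \<and>
             (\<forall>C. compact C \<and> C \<subseteq> \<Omega> \<longrightarrow> (\<exists>M. holder_bound \<alpha> C v M)))) \<and>
     (\<forall>u. \<forall>g\<in>T. weak_solution \<Omega> a b c q u \<and> (\<lambda>x. u x - g x) \<in> H1_0 \<Omega> \<longrightarrow>
        (\<exists>v\<in>holder_space 0 \<alpha> (closure \<Omega>). AE x in lebesgue_on \<Omega>. v x = u x))"

definition regular_coefficients ::
    "nat \<Rightarrow> real \<Rightarrow> (real^'d) set \<Rightarrow> (real^'d \<Rightarrow> real^'d^'d) \<Rightarrow> (real^'d \<Rightarrow> real^'d) \<Rightarrow>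
     (real^'d \<Rightarrow> real^'d) \<Rightarrow> (real^'d \<Rightarrow> real) \<Rightarrow> (real^'d \<Rightarrow> real) set \<Rightarrow> bool" where
  "regular_coefficients l \<alpha> \<Omega> a b c q T \<longleftrightarrow>
     (if l = 0 then
        a \<in> Linf_space \<Omega> \<and> b \<in> Linf_space \<Omega> \<and> c \<in> Linf_space \<Omega> \<and> q \<in> Linf_space \<Omega> \<and>
        T \<subseteq> H1 \<Omega> \<and> solution_holder_exponent \<Omega> a b c q T \<alpha>
      else
        a \<in> holder_space (l - 1) \<alpha> (closure \<Omega>) \<and> b \<in> holder_space (l - 1) \<alpha> (closure \<Omega>) \<and>
        c \<in> W_inf (l - 1) \<Omega> \<and> q \<in> W_inf (l - 1) \<Omega>)"

section \<open>The solution space and the admissible set\<close>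

text \<open>
  An element of \<open>H(K)\<close> is represented by a function, and two functions that agree on \<open>K\<close> and
  almost everywhere on \<open>\<Omega>\<close> represent the same element. They are at distance \<open>0\<close>, hence
  topologically indistinguishable below, so that open and dense sets are the same as in the
  quotient.
\<close>

definition HK ::
    "nat \<Rightarrow> real \<Rightarrow> (real^'d) set \<Rightarrow> (real^'d \<Rightarrow> real^'d^'d) \<Rightarrow> (real^'d \<Rightarrow> real^'d) \<Rightarrow>
     (real^'d \<Rightarrow> real^'d) \<Rightarrow> (real^'d \<Rightarrow> real) \<Rightarrow> (real^'d) set \<Rightarrow> (real^'d \<Rightarrow> real) set" where
  "HK l \<alpha> \<Omega> a b c q K = {u \<in> holder_space l \<alpha> K \<inter> H1 \<Omega>. weak_solution \<Omega> a b c q u}"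

definition HK_norm ::
    "nat \<Rightarrow> real \<Rightarrow> (real^'d) set \<Rightarrow> (real^'d) set \<Rightarrow> (real^'d \<Rightarrow> real) \<Rightarrow> real" where
  "HK_norm l \<alpha> \<Omega> K u = holder_norm l \<alpha> K u + H1_norm \<Omega> u"

definition norm_topology :: "('a \<Rightarrow> 'b::ab_group_add) set \<Rightarrow> (('a \<Rightarrow> 'b) \<Rightarrow> real) \<Rightarrow> ('a \<Rightarrow> 'b) topology" where
  "norm_topology S N =
     topology_generated_by {{v\<in>S. N (\<lambda>x. v x - u x) < r} | u r. u \<in> S \<and> 0 < r}"

lemma topspace_norm_topology [simp]: "topspace (norm_topology S N) = S"
proof
  show "topspace (norm_topology S N) \<subseteq> S"
    by (auto simp: norm_topology_def topology_generated_by_topspace)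
  show "S \<subseteq> topspace (norm_topology S N)"
  proof
    fix v assume v: "v \<in> S"
    define r where "r = \<bar>N (\<lambda>x. v x - v x)\<bar> + 1"
    have r: "0 < r" "N (\<lambda>x. v x - v x) < r"
      unfolding r_def by linarith+
    let ?B = "{w\<in>S. N (\<lambda>x. w x - v x) < r}"
    have "v \<in> ?B" using v r(2) by blast
    moreover have "?B \<in> {{w\<in>S. N (\<lambda>x. w x - u x) < r} | u r. u \<in> S \<and> 0 < r}"
      using v r(1) by blast
    ultimately show "v \<in> topspace (norm_topology S N)"
      unfolding norm_topology_def topology_generated_by_topspace by (rule UnionI[rotated])
  qed
qed

definition HK_topology ::
    "nat \<Rightarrow> real \<Rightarrow> (real^'d) set \<Rightarrow> (real^'d \<Rightarrow> real^'d^'d) \<Rightarrow> (real^'d \<Rightarrow> real^'d) \<Rightarrow>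
     (real^'d \<Rightarrow> real^'d) \<Rightarrow> (real^'d \<Rightarrow> real) \<Rightarrow> (real^'d) set \<Rightarrow> (real^'d \<Rightarrow> real) topology" where
  "HK_topology l \<alpha> \<Omega> a b c q K = norm_topology (HK l \<alpha> \<Omega> a b c q K) (HK_norm l \<alpha> \<Omega> K)"

definition holder_topology :: "nat \<Rightarrow> real \<Rightarrow> 'a::euclidean_space set \<Rightarrow> ('a \<Rightarrow> 'b::real_normed_vector) topology" where
  "holder_topology k \<alpha> K = norm_topology (holder_space k \<alpha> K) (holder_norm k \<alpha> K)"

text \<open>
  As a function on \<open>K\<close> is represented by its extensions, linearity is required on \<open>K\<close> only.
  Continuity forces the values of \<open>\<zeta> u\<close> on \<open>K\<close> to depend only on those of \<open>u\<close> on \<open>K\<close>.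
\<close>

definition continuous_linear_holder ::
    "nat \<Rightarrow> real \<Rightarrow> (real^'d) set \<Rightarrow> ((real^'d \<Rightarrow> real) \<Rightarrow> real^'d \<Rightarrow> real^'n) \<Rightarrow> bool" where
  "continuous_linear_holder l \<alpha> K \<zeta> \<longleftrightarrow>
     (\<forall>u\<in>holder_space l \<alpha> K. \<forall>v\<in>holder_space l \<alpha> K. \<forall>x\<in>K. \<zeta> (\<lambda>y. u y + v y) x = \<zeta> u x + \<zeta> v x) \<and>
     (\<forall>r. \<forall>u\<in>holder_space l \<alpha> K. \<forall>x\<in>K. \<zeta> (\<lambda>y. r * u y) x = r *\<^sub>R \<zeta> u x) \<and>
     continuous_map (holder_topology l \<alpha> K) (holder_topology 0 \<alpha> K) \<zeta>"

definition candidate_set ::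
    "(real^'d \<Rightarrow> real) set \<Rightarrow> ((real^'d \<Rightarrow> real) \<Rightarrow> real^'d \<Rightarrow> real^'n) \<Rightarrow> (real^'d) set \<Rightarrow> (real^'d) set" where
  "candidate_set H \<zeta> K =
     {x\<in>K. \<exists>u :: 'n \<Rightarrow> real^'d \<Rightarrow> real. (\<forall>j. u j \<in> H) \<and> det (\<chi> j. \<zeta> (u j) x) \<noteq> 0}"

definition admissible_set ::
    "nat \<Rightarrow> (real^'d \<Rightarrow> real) set \<Rightarrow> ((real^'d \<Rightarrow> real) \<Rightarrow> real^'d \<Rightarrow> real^'n) \<Rightarrow> (real^'d) set \<Rightarrow>
     (nat \<Rightarrow> real^'d \<Rightarrow> real) set" where
  "admissible_set N H \<zeta> K =
     {u \<in> {..<N} \<rightarrow>\<^sub>E H.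
        \<forall>x\<in>K. (\<Sum>i\<in>(UNIV :: 'n set) \<rightarrow>\<^sub>E {..<N}. \<bar>det (\<chi> j. \<zeta> (u (i j)) x)\<bar>) > 0}"

end

theory Submission
  imports Defs
begin

text \<open>
  Openness is compactness of \<open>K\<close>: the rows \<open>\<zeta>(u\<^sub>i)(x)\<close> have rank \<open>n\<close> at every \<open>x\<close> if and only if
  \<open>\<Sum>\<^sub>i \<bar>\<zeta>(u\<^sub>i)(x) \<bullet> \<xi>\<bar>\<close> is bounded below on \<open>K\<close> times the unit sphere.

  For density, compactness yields finitely many \<open>f \<in> H(K)\<close> whose images \<open>\<zeta>(f)(x)\<close> span at every
  \<open>x \<in> K\<close>, and one perturbs \<open>u\<^sub>i\<close> to \<open>u\<^sub>i + \<Sum>\<^sub>f t\<^sub>i\<^sub>f f\<close> with \<open>t\<^sub>i\<^sub>f\<close> in a grid of \<open>L\<close> points in \<open>[0, \<epsilon>]\<close>. Being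
  degenerate is tested on pairs \<open>(x, \<xi>)\<close> with \<open>\<xi>\<close> normalised in the maximum norm. By Hoelder
  continuity it suffices to avoid values of size \<open>O(1/L)\<close> on a net of mesh \<open>L\<^sup>-\<^sup>1\<^sup>/\<^sup>\<alpha>\<close> in \<open>x\<close> and \<open>1/L\<close> in \<open>\<xi>\<close>,
  which has \<open>O(L\<^sup>d\<^sup>/\<^sup>\<alpha>\<^sup>+\<^sup>n\<^sup>-\<^sup>1)\<close> points. For each of them a proportion \<open>O(1/L)\<close> of the coefficients of each row
  is bad, hence a proportion \<open>O(L\<^sup>-\<^sup>N)\<close> of all coefficients. As \<open>N = \<lfloor>(d + n)/\<alpha>\<rfloor> > d/\<alpha> + n - 1\<close>, some
  choice of coefficients is good for large \<open>L\<close>.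
\<close>

section \<open>Avoiding degenerate combinations\<close>

text \<open>The values of \<zeta> are only Hoelder continuous, so a Sard-type argument in x is out
  of reach; what survives is counting. Measured by the \<alpha>-th power of the distance, K has
  dimension at most d/\<alpha>, and directions \<xi> up to scaling contribute n - 1. Degeneracy at
  (x, \<xi>) amounts to N scalar equations, one per row, which a generic choice avoids once N >
  d/\<alpha> + n - 1. The integer part exceeds (d + n)/\<alpha> - 1, and n/\<alpha> \<ge> n because
  \<alpha> < 1; this is how the exponent of the theorem meets that bound. The spacing of the
  coefficient grid and the threshold to be exceeded at net points are both of order 1/L. Their
  quotient does not depend on L, so with all other coefficients of a row frozen, only boundedly many
  values of a suitable one are bad. The bound is uniform in (x, \<xi>) because some member of the
  spanning family has a pairing with \<xi> bounded away from 0. Rows are chosen independently, so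
  the bad proportions multiply, and a finite grid turns this probabilistic argument into a
  comparison of cardinalities.\<close>

lemma grid_net:
  fixes S :: "(real^'n) set" and J :: "'n set" and R m :: nat
  assumes bd: "\<And>x i. x \<in> S \<Longrightarrow> \<bar>x $ i\<bar> \<le> real R"
    and const: "\<And>x y i. x \<in> S \<Longrightarrow> y \<in> S \<Longrightarrow> i \<notin> J \<Longrightarrow> x $ i = y $ i"
    and m: "0 < m"
  obtains P where "P \<subseteq> S" "finite P" "card P \<le> ((2 * R + 1) * m) ^ card J"
    "\<And>x. x \<in> S \<Longrightarrow> \<exists>p\<in>P. dist x p \<le> real CARD('n) / real m"
proof -
  \<comment> \<open>Points of \<open>S\<close> with equal codes lie in a common cell of side 1/m;
    coordinates outside \<open>J\<close> agree on \<open>S\<close> anyway and cost nothing in the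
    count.\<close>
  define code where "code x = restrict (\<lambda>i. \<lfloor>real m * x $ i\<rfloor>) J" for x :: "real^'n"
  \<comment> \<open>Net points are chosen from \<open>S\<close> itself rather than from the cell
    corners, since the later lower bounds are available only at points of \<open>S\<close>.\<close>
  define rep where "rep y = (SOME x. x \<in> S \<and> code x = y)" for y
  have rep: "rep (code x) \<in> S \<and> code (rep (code x)) = code x" if "x \<in> S" for x
    unfolding rep_def by (rule someI[of _ x]) (use that in auto)
  have sub: "code ` S \<subseteq> J \<rightarrow>\<^sub>E {- int (R * m)..int (R * m)}"
  proof (clarsimp simp: code_def PiE_iff)
    fix x i assume x: "x \<in> S" and "i \<in> J"
    have "\<bar>real m * x $ i\<bar> \<le> real (R * m)"
      using mult_left_mono[OF bd[OF x, of i], of "real m"] by (simp add: abs_mult mult.commute)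
    then have "real_of_int (- int (R * m)) \<le> real m * x $ i" "real m * x $ i \<le> real_of_int (int (R * m))"
      by (auto simp: abs_le_iff)
    then show "- (int R * int m) \<le> \<lfloor>real m * x $ i\<rfloor> \<and> \<lfloor>real m * x $ i\<rfloor> \<le> int R * int m"
      unfolding of_nat_mult[symmetric] by (metis floor_le_iff floor_mono floor_of_int le_floor_iff)
  qed
  have fin: "finite (J \<rightarrow>\<^sub>E {- int (R * m)..int (R * m)})"
    by (intro finite_PiE) auto
  have "card (code ` S) \<le> card (J \<rightarrow>\<^sub>E {- int (R * m)..int (R * m)})"
    by (rule card_mono[OF fin sub])
  also have "\<dots> = (2 * (R * m) + 1) ^ card J"
    by (simp add: card_PiE nat_add_distrib nat_mult_distrib)
  \<comment> \<open>Since m \<ge> 1, the additive 1 is absorbed, leaving a pure power of m for the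
    later comparison of exponents.\<close>
  also have "\<dots> \<le> ((2 * R + 1) * m) ^ card J"
    using m by (intro power_mono) (auto simp: algebra_simps)
  finally have card: "card (code ` S) \<le> ((2 * R + 1) * m) ^ card J" .
  have fin': "finite (code ` S)" by (rule finite_subset[OF sub fin])
  show thesis
  proof (rule that[of "rep ` code ` S"])
    show "rep ` code ` S \<subseteq> S" using rep by auto
    show "finite (rep ` code ` S)" using fin' by simp
    show "card (rep ` code ` S) \<le> ((2 * R + 1) * m) ^ card J"
      using card_image_le[OF fin', of rep] card by linarith
    fix x assume x: "x \<in> S"
    let ?p = "rep (code x)"
    have close: "\<bar>(x - ?p) $ i\<bar> \<le> 1 / real m" for i
    proof (cases "i \<in> J")
      case True
      have "code ?p i = code x i" using rep[OF x] by simp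
      then have "\<lfloor>real m * x $ i\<rfloor> = \<lfloor>real m * ?p $ i\<rfloor>" using True by (simp add: code_def)
      then have "\<bar>real m * x $ i - real m * ?p $ i\<bar> \<le> 1" by linarith
      then have "real m * \<bar>x $ i - ?p $ i\<bar> \<le> 1"
        by (simp add: right_diff_distrib[symmetric] abs_mult)
      then show ?thesis using m by (simp add: field_simps)
    next
      case False
      then show ?thesis using const[OF x _ False, of ?p] rep[OF x] by simp
    qed
    have "dist x ?p \<le> (\<Sum>i\<in>UNIV. \<bar>(x - ?p) $ i\<bar>)"
      unfolding dist_norm by (rule norm_le_l1_cart)
    also have "\<dots> \<le> (\<Sum>i\<in>(UNIV::'n set). 1 / real m)"
      by (intro sum_mono close)
    finally show "\<exists>p\<in>rep ` code ` S. dist x p \<le> real CARD('n) / real m"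
      using x by (intro bexI[of _ ?p]) auto
  qed
qed

text \<open>Consecutive terms of the progression differ by at least h * c, and all hits lie in an
  interval of length 2 * \<eta>. Counting starts from the smallest hit, so neither the sign of y nor
  the position of w matters.\<close>

lemma card_multiples_near_le:
  fixes w y \<eta> c h :: real and L :: nat
  assumes "c \<le> \<bar>y\<bar>" "0 < c" "0 < h" "0 \<le> \<eta>"
  shows "real (card {s\<in>{..<L}. \<bar>w + h * real s * y\<bar> \<le> \<eta>}) \<le> 2 * \<eta> / (h * c) + 1"
proof -
  define A where "A = {s\<in>{..<L}. \<bar>w + h * real s * y\<bar> \<le> \<eta>}"
  show ?thesis
  proof (cases "A = {}")
    case True
    then show ?thesis using assms unfolding A_def[symmetric] by simp
  next
    case False
    have finA: "finite A" by (simp add: A_def)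
    define a where "a = Min A"
    have aA: "a \<in> A" unfolding a_def using finA False by simp
    have "A \<subseteq> {a..a + nat \<lfloor>2 * \<eta> / (h * c)\<rfloor>}"
    proof
      fix s assume s: "s \<in> A"
      have as: "a \<le> s" unfolding a_def using finA s by simp
      have "\<bar>(w + h * real s * y) - (w + h * real a * y)\<bar> \<le> 2 * \<eta>"
        using s aA unfolding A_def by (auto simp: abs_le_iff)
      moreover have "(w + h * real s * y) - (w + h * real a * y) = h * (real s - real a) * y"
        by (simp add: algebra_simps)
      ultimately have "h * (real s - real a) * \<bar>y\<bar> \<le> 2 * \<eta>"
        using as assms by (simp add: abs_mult)
      moreover have "h * (real s - real a) * c \<le> h * (real s - real a) * \<bar>y\<bar>"
        using as assms by (intro mult_left_mono) auto
      ultimately have "(real s - real a) \<le> 2 * \<eta> / (h * c)"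
        using assms by (simp add: field_simps)
      then have "int s - int a \<le> \<lfloor>2 * \<eta> / (h * c)\<rfloor>"
        by (simp add: le_floor_iff)
      then show "s \<in> {a..a + nat \<lfloor>2 * \<eta> / (h * c)\<rfloor>}"
        using as by auto
    qed
    then have "card A \<le> card {a..a + nat \<lfloor>2 * \<eta> / (h * c)\<rfloor>}"
      by (intro card_mono) auto
    then have "real (card A) \<le> real (nat \<lfloor>2 * \<eta> / (h * c)\<rfloor>) + 1" by simp
    also have "\<dots> \<le> 2 * \<eta> / (h * c) + 1"
      using assms by (simp add: of_nat_nat)
    finally show ?thesis unfolding A_def .
  qed
qed

lemma card_small_combinations_le:
  fixes y :: "'f \<Rightarrow> real" and w \<eta> c h :: real and L :: nat
  assumes F: "finite F" "k \<in> F" "c \<le> \<bar>y k\<bar>" and pos: "0 < c" "0 < h" "0 \<le> \<eta>"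
  shows "real (card {s \<in> F \<rightarrow>\<^sub>E {..<L}. \<bar>w + (\<Sum>f\<in>F. h * real (s f) * y f)\<bar> \<le> \<eta>})
           \<le> real L ^ (card F - 1) * (2 * \<eta> / (h * c) + 1)"
proof -
  define B where "B = {s \<in> F \<rightarrow>\<^sub>E {..<L}. \<bar>w + (\<Sum>f\<in>F. h * real (s f) * y f)\<bar> \<le> \<eta>}"
  define G where "G = (F - {k}) \<rightarrow>\<^sub>E {..<L}"
  define V where "V g = {v\<in>{..<L}. \<bar>(w + (\<Sum>f\<in>F-{k}. h * real (g f) * y f)) + h * real v * y k\<bar> \<le> \<eta>}" for g
  have finG: "finite G" unfolding G_def using F by (intro finite_PiE) auto
  have "B \<subseteq> (\<Union>g\<in>G. (\<lambda>v. g(k := v)) ` V g)"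
  proof
    fix s assume s: "s \<in> B"
    \<comment> \<open>Resetting the value at \<open>k\<close> to \<open>undefined\<close> makes g
      extensional on F - {k}, so that g is counted by \<open>G\<close>.\<close>
    define g where "g = s(k := undefined)"
    have "g \<in> G" using s unfolding B_def G_def g_def PiE_def extensional_def by auto
    moreover have "s = g(k := s k)" by (simp add: g_def)
    moreover have "s k \<in> V g"
    proof -
      have "(\<Sum>f\<in>F. h * real (s f) * y f) = h * real (s k) * y k + (\<Sum>f\<in>F-{k}. h * real (s f) * y f)"
        using F by (simp add: sum.remove)
      moreover have "(\<Sum>f\<in>F-{k}. h * real (s f) * y f) = (\<Sum>f\<in>F-{k}. h * real (g f) * y f)"
        by (intro sum.cong) (auto simp: g_def)
      moreover have "\<bar>w + (\<Sum>f\<in>F. h * real (s f) * y f)\<bar> \<le> \<eta>" "s k < L"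
        using s F unfolding B_def by auto
      ultimately show ?thesis unfolding V_def by (auto simp: algebra_simps)
    qed
    ultimately show "s \<in> (\<Union>g\<in>G. (\<lambda>v. g(k := v)) ` V g)" by blast
  qed
  then have "card B \<le> card (\<Union>g\<in>G. (\<lambda>v. g(k := v)) ` V g)"
    using finG by (intro card_mono) (auto simp: V_def)
  also have "\<dots> \<le> (\<Sum>g\<in>G. card ((\<lambda>v. g(k := v)) ` V g))"
    by (rule card_UN_le[OF finG])
  also have "\<dots> \<le> (\<Sum>g\<in>G. card (V g))"
    by (intro sum_mono card_image_le) (auto simp: V_def)
  finally have "real (card B) \<le> (\<Sum>g\<in>G. real (card (V g)))"
    by (metis of_nat_le_iff of_nat_sum)
  also have "\<dots> \<le> (\<Sum>g\<in>G. 2 * \<eta> / (h * c) + 1)"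
    unfolding V_def using F pos by (intro sum_mono card_multiples_near_le) auto
  also have "\<dots> = real (card G) * (2 * \<eta> / (h * c) + 1)" by simp
  also have "real (card G) = real L ^ (card F - 1)"
    using F unfolding G_def by (simp add: card_PiE)
  finally show ?thesis unfolding B_def .
qed

text \<open>A union bound over P. For fixed p the bad assignments form a product over the rows i <
  N, because the coefficients of different rows are unrelated; this produces the N-th power in
  \<open>few\<close>.\<close>

lemma exists_avoiding_combination:
  fixes z :: "nat \<Rightarrow> 'p \<Rightarrow> real" and y :: "'f \<Rightarrow> 'p \<Rightarrow> real" and \<eta> c h :: real and L N :: nat
  assumes F: "finite F" "F \<noteq> {}" and P: "finite P" "\<And>p. p \<in> P \<Longrightarrow> \<exists>f\<in>F. c \<le> \<bar>y f p\<bar>"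
    and pos: "0 < c" "0 < h" "0 \<le> \<eta>" "0 < L"
    and few: "real (card P) * (2 * \<eta> / (h * c) + 1) ^ N < real L ^ N"
  obtains s where "\<And>i f. i < N \<Longrightarrow> f \<in> F \<Longrightarrow> s i f < L"
    "\<And>p. p \<in> P \<Longrightarrow> \<exists>i<N. \<eta> < \<bar>z i p + (\<Sum>f\<in>F. h * real (s i f) * y f p)\<bar>"
proof -
  define B where "B p i = {s \<in> F \<rightarrow>\<^sub>E {..<L}. \<bar>z i p + (\<Sum>f\<in>F. h * real (s f) * y f p)\<bar> \<le> \<eta>}" for p i
  define C where "C = 2 * \<eta> / (h * c) + 1"
  define G where "G = {..<N} \<rightarrow>\<^sub>E (F \<rightarrow>\<^sub>E {..<L})"
  have finFL: "finite (F \<rightarrow>\<^sub>E {..<L})" using F by (intro finite_PiE) auto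
  have finG: "finite G" unfolding G_def by (rule finite_PiE) (use finFL in auto)
  have cardB: "real (card (B p i)) \<le> real L ^ (card F - 1) * C" if p: "p \<in> P" for p i
  proof -
    obtain k where "k \<in> F" "c \<le> \<bar>y k p\<bar>" using P(2)[OF p] by blast
    then show ?thesis unfolding B_def C_def
      using card_small_combinations_le[of F k c "\<lambda>f. y f p"] F pos by blast
  qed
  have finB: "finite (B p i)" for p i unfolding B_def using finFL by auto
  have card1: "real (card ({..<N} \<rightarrow>\<^sub>E (F \<rightarrow>\<^sub>E {..<L}))) = real L ^ (card F * N)"
    using F by (simp add: card_PiE power_mult)
  have card2: "real (card (PiE {..<N} (B p))) \<le> (real L ^ (card F - 1) * C) ^ N" if "p \<in> P" for p
  proof -
    have "real (card (PiE {..<N} (B p))) = (\<Prod>i<N. real (card (B p i)))" by (simp add: card_PiE)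
    also have "\<dots> \<le> (\<Prod>i<N. real L ^ (card F - 1) * C)"
      by (intro prod_mono) (use cardB[OF that] in auto)
    finally show ?thesis by simp
  qed
  have "real (card (\<Union>p\<in>P. PiE {..<N} (B p))) \<le> (\<Sum>p\<in>P. real (card (PiE {..<N} (B p))))"
    using card_UN_le[OF P(1)] by (metis of_nat_le_iff of_nat_sum)
  also have "\<dots> \<le> (\<Sum>p\<in>P. (real L ^ (card F - 1) * C) ^ N)"
    by (intro sum_mono card2)
  also have "\<dots> = (real L ^ (card F - 1)) ^ N * (real (card P) * C ^ N)"
    by (simp add: power_mult_distrib)
  \<comment> \<open>The assumption \<open>few\<close> is the desired comparison of cardinalities
    after division by the common factor (L ^ (card F - 1)) ^ N.\<close>
  also have "\<dots> < (real L ^ (card F - 1)) ^ N * real L ^ N"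
    using few pos unfolding C_def by (intro mult_strict_left_mono) auto
  also have "\<dots> = (real L ^ (card F - 1) * real L ^ 1) ^ N"
    by (simp add: power_mult_distrib)
  also have "\<dots> = (real L ^ card F) ^ N"
    using F by (subst power_add[symmetric]) (simp add: card_gt_0_iff Suc_leI)
  also have "\<dots> = real (card G)" unfolding G_def card1 by (simp add: power_mult)
  finally have "card (\<Union>p\<in>P. PiE {..<N} (B p)) < card G" by simp
  then have "\<not> G \<subseteq> (\<Union>p\<in>P. PiE {..<N} (B p))"
    using card_mono[of "\<Union>p\<in>P. PiE {..<N} (B p)" G] P finB
    by (meson finite_PiE finite_UN_I finite_lessThan not_le)
  then obtain s where s: "s \<in> G" "\<And>p. p \<in> P \<Longrightarrow> s \<notin> PiE {..<N} (B p)" by blast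
  show thesis
  proof (rule that[of s])
    show "s i f < L" if "i < N" "f \<in> F" for i f
      using s(1) that unfolding G_def by (auto simp: PiE_iff)
    fix p assume p: "p \<in> P"
    obtain i where i: "i < N" "s i \<notin> B p i"
      using s(1) s(2)[OF p] unfolding G_def PiE_iff by blast
    then have "s i \<in> F \<rightarrow>\<^sub>E {..<L}" using s(1) unfolding G_def by (auto simp: PiE_iff)
    then show "\<exists>i<N. \<eta> < \<bar>z i p + (\<Sum>f\<in>F. h * real (s i f) * y f p)\<bar>"
      using i unfolding B_def by (auto simp: not_le)
  qed
qed

text \<open>With m about L powr (1/\<alpha>), the left-hand side grows like L to the power
  d/\<alpha> + k. The surplus exponent r = N - (d/\<alpha> + k) is positive, so it suffices that L
  powr r dominates the constant factor.\<close>

lemma exists_large_scale: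
  fixes A C \<alpha> :: real and d k N :: nat
  assumes "0 < \<alpha>" "0 \<le> A" "real d / \<alpha> + real k < real N"
  obtains L m :: nat where "0 < L" "0 < m" "(1 / real m) powr \<alpha> \<le> 1 / real L"
    "A * real m ^ d * real L ^ k < real L ^ N"
proof -
  define r where "r = real N - (real d / \<alpha> + real k)"
  have r: "r > 0" using assms by (simp add: r_def)
  \<comment> \<open>The factor 2 ^ d pays for rounding m up. The summand 1 makes the final
    inequality strict, also for A = 0.\<close>
  define D where "D = A * 2 ^ d + 1"
  have D: "D \<ge> 1" using assms by (simp add: D_def)
  define L where "L = nat \<lceil>D powr (1 / r)\<rceil> + 1"
  have "D powr (1 / r) \<le> real (nat \<lceil>D powr (1 / r)\<rceil>)" by (rule real_nat_ceiling_ge)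
  then have L: "0 < L" "D powr (1 / r) < real L" unfolding L_def by (simp, linarith)
  have Lge: "1 \<le> real L powr (1 / \<alpha>)" using L assms by (intro ge_one_powr_ge_zero) auto
  define m where "m = nat \<lceil>real L powr (1 / \<alpha>)\<rceil>"
  have m1: "real L powr (1 / \<alpha>) \<le> real m" unfolding m_def by (rule real_nat_ceiling_ge)
  \<comment> \<open>Rounding up a number t \<ge> 1 gives at most t + 1 \<le> 2 * t.\<close>
  have m2: "real m \<le> 2 * real L powr (1 / \<alpha>)"
    unfolding m_def using Lge by (subst of_nat_nat) linarith+
  have m: "0 < m" using m1 Lge by (cases m) auto
  show thesis
  proof (rule that[OF L(1) m])
    have "real L = (real L powr (1 / \<alpha>)) powr \<alpha>" using L assms by (simp add: powr_powr)
    also have "\<dots> \<le> real m powr \<alpha>" using m1 assms by (intro powr_mono2) auto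
    finally show "(1 / real m) powr \<alpha> \<le> 1 / real L"
      using L m by (simp add: powr_divide field_simps)
    have "A * real m ^ d * real L ^ k \<le> A * (2 * real L powr (1 / \<alpha>)) ^ d * real L ^ k"
      using m2 assms by (intro mult_right_mono mult_left_mono power_mono) auto
    also have "\<dots> = A * 2 ^ d * real L powr (real d / \<alpha> + real k)"
    proof -
      have "(real L powr (1 / \<alpha>)) ^ d = real L powr (real d / \<alpha>)"
        using L by (simp add: powr_realpow[symmetric] powr_powr del: powr_realpow)
      then show ?thesis using L by (simp add: power_mult_distrib powr_add powr_realpow)
    qed
    also have "\<dots> < D * real L powr (real d / \<alpha> + real k)"
      using L by (intro mult_strict_right_mono) (auto simp: D_def)
    also have "D = (D powr (1 / r)) powr r" using D r by (simp add: powr_powr)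
    also have "\<dots> * real L powr (real d / \<alpha> + real k) \<le> real L powr r * real L powr (real d / \<alpha> + real k)"
      using L r by (intro mult_right_mono powr_mono2) auto
    also have "\<dots> = real L ^ N"
      using L by (simp add: powr_add[symmetric] r_def powr_realpow)
    finally show "A * real m ^ d * real L ^ k < real L ^ N" .
  qed
qed

text \<open>
  Normalising \<open>\<xi>\<close> by \<open>\<xi>\<^sub>j = 1\<close> saves one dimension in the net, without which the bound on \<open>N\<close>
  in the theorem would not suffice.
\<close>

lemma exists_nonvanishing_combination:
  fixes K :: "(real^'d) set" and z :: "nat \<Rightarrow> real^'d \<Rightarrow> real^'n" and y :: "'f \<Rightarrow> real^'d \<Rightarrow> real^'n"
    and \<alpha> H B c \<epsilon> :: real and N :: nat
  assumes K: "bounded K" and \<alpha>: "0 < \<alpha>" "\<alpha> \<le> 1"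
    and N: "real CARD('d) / \<alpha> + real (CARD('n) - 1) < real N"
    and F: "finite F"
    and zH: "\<And>i x x'. i < N \<Longrightarrow> x \<in> K \<Longrightarrow> x' \<in> K \<Longrightarrow> norm (z i x - z i x') \<le> H * dist x x' powr \<alpha>"
    and yH: "\<And>f x x'. f \<in> F \<Longrightarrow> x \<in> K \<Longrightarrow> x' \<in> K \<Longrightarrow> norm (y f x - y f x') \<le> H * dist x x' powr \<alpha>"
    and zB: "\<And>i x. i < N \<Longrightarrow> x \<in> K \<Longrightarrow> norm (z i x) \<le> B"
    and yB: "\<And>f x. f \<in> F \<Longrightarrow> x \<in> K \<Longrightarrow> norm (y f x) \<le> B"
    and HB: "0 \<le> H" "0 \<le> B"
    and c: "0 < c" "\<And>x \<xi>. x \<in> K \<Longrightarrow> (\<exists>j. \<xi> $ j = 1) \<Longrightarrow> (\<And>i. \<bar>\<xi> $ i\<bar> \<le> 1) \<Longrightarrow> \<exists>f\<in>F. c \<le> \<bar>y f x \<bullet> \<xi>\<bar>"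
    and \<epsilon>: "0 < \<epsilon>"
  obtains t :: "nat \<Rightarrow> 'f \<Rightarrow> real" where "\<And>i f. i < N \<Longrightarrow> f \<in> F \<Longrightarrow> \<bar>t i f\<bar> \<le> \<epsilon>"
    "\<And>x \<xi>. x \<in> K \<Longrightarrow> \<xi> \<noteq> 0 \<Longrightarrow> \<exists>i<N. (z i x + (\<Sum>f\<in>F. t i f *\<^sub>R y f x)) \<bullet> \<xi> \<noteq> 0"
proof (cases "K = {}")
  case True
  show thesis by (rule that[of "\<lambda>_ _. 0"]) (use True \<epsilon> in auto)
next
  case False
  define d where "d = CARD('d)"
  define n where "n = CARD('n)"
  have dn: "d \<ge> 1" "n \<ge> 1" unfolding d_def n_def by (auto simp: Suc_leI)
  have F0: "F \<noteq> {}"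
  proof -
    obtain x where "x \<in> K" using False by blast
    then show ?thesis using c(2)[of x "\<chi> i. 1"] by auto
  qed
  obtain R :: nat where R: "\<And>x i. x \<in> K \<Longrightarrow> \<bar>x $ i\<bar> \<le> real R"
  proof -
    obtain b where "\<And>x. x \<in> K \<Longrightarrow> norm x \<le> b" using K by (auto simp: bounded_iff)
    then show thesis
      using that[of "nat \<lceil>b\<rceil>"] by (meson component_le_norm_cart order_trans real_nat_ceiling_ge)
  qed
  define S where "S j = {\<xi> :: real^'n. \<xi> $ j = 1 \<and> (\<forall>i. \<bar>\<xi> $ i\<bar> \<le> 1)}" for j
  \<comment> \<open>Adding combinations with coefficients of modulus at most \<epsilon> multiplies
    both the bound B and the Hoelder constant H by at most Q.\<close>
  define Q where "Q = 1 + \<epsilon> * real (card F)"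
  have Q: "Q \<ge> 1" using \<epsilon> by (simp add: Q_def)
  \<comment> \<open>\<kappa>/L bounds the change of W i x \<bullet> \<xi> between (x, \<xi>) and its
    net point: the first summand comes from moving x, the second from moving \<xi>.\<close>
  define \<kappa> where "\<kappa> = H * Q * real d * real n + B * Q * real n"
  have \<kappa>: "\<kappa> \<ge> 0" using HB Q by (simp add: \<kappa>_def)
  define C where "C = 2 * \<kappa> / (\<epsilon> * c) + 1"
  have C: "C \<ge> 1" using \<kappa> \<epsilon> c by (simp add: C_def)
  \<comment> \<open>The factors are: n faces on which some coordinate of \<xi> is 1, the net of K,
    the net of one such face (a cube of dimension n - 1 with R = 1), and the bad counts of N
    rows.\<close>
  define A where "A = real n * (2 * real R + 1) ^ d * 3 ^ (n - 1) * C ^ N"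
  have "0 \<le> A" using C by (simp add: A_def)
  then obtain L m :: nat where L: "0 < L" "0 < m" "(1 / real m) powr \<alpha> \<le> 1 / real L"
      "A * real m ^ d * real L ^ (n - 1) < real L ^ N"
    using exists_large_scale[of \<alpha> A d "n - 1" N] \<alpha> N unfolding d_def n_def by blast
  \<comment> \<open>The step h keeps the coefficients h * s with s < L in [0, \<epsilon>]. As h and
    \<eta> both scale like 1/L, the count 2 * \<eta> / (h * c) + 1 is the constant C.\<close>
  define h where "h = \<epsilon> / real L"
  define \<eta> where "\<eta> = \<kappa> / real L"
  have h: "0 < h" using \<epsilon> L by (simp add: h_def)
  have \<eta>: "0 \<le> \<eta>" using \<kappa> L by (simp add: \<eta>_def)
  have C_eq: "2 * \<eta> / (h * c) + 1 = C" using L \<epsilon> by (simp add: \<eta>_def h_def C_def)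
  obtain P where P: "P \<subseteq> K" "finite P" "card P \<le> ((2 * R + 1) * m) ^ d"
      "\<And>x. x \<in> K \<Longrightarrow> \<exists>p\<in>P. dist x p \<le> real d / real m"
    using grid_net[of K R UNIV m] R L unfolding d_def by auto
  have "\<exists>P. P \<subseteq> S j \<and> finite P \<and> card P \<le> (3 * L) ^ (n - 1) \<and>
      (\<forall>x\<in>S j. \<exists>p\<in>P. dist x p \<le> real n / real L)" for j
  proof -
    have "card (UNIV - {j}) = n - 1" unfolding n_def by (simp add: card_Diff_singleton)
    moreover have "x $ i = y $ i" if "x \<in> S j" "y \<in> S j" "i \<notin> UNIV - {j}" for x y i
      using that by (auto simp: S_def)
    moreover have "\<bar>x $ i\<bar> \<le> real 1" if "x \<in> S j" for x i using that by (auto simp: S_def)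
    ultimately obtain P where "P \<subseteq> S j" "finite P" "card P \<le> ((2 * 1 + 1) * L) ^ (n - 1)"
        "\<And>x. x \<in> S j \<Longrightarrow> \<exists>p\<in>P. dist x p \<le> real n / real L"
      using grid_net[of "S j" 1 "UNIV - {j}" L] L(1) unfolding n_def by metis
    then show ?thesis by (intro exI[of _ P]) simp
  qed
  then obtain P' where P': "\<And>j. P' j \<subseteq> S j" "\<And>j. finite (P' j)" "\<And>j. card (P' j) \<le> (3 * L) ^ (n - 1)"
      "\<And>j x. x \<in> S j \<Longrightarrow> \<exists>p\<in>P' j. dist x p \<le> real n / real L"
    by metis
  define PP where "PP = P \<times> (\<Union>j. P' j)"
  have finPP: "finite PP" unfolding PP_def using P P' by auto
  have "card (\<Union>j. P' j) \<le> (\<Sum>j\<in>(UNIV :: 'n set). card (P' j))" by (rule card_UN_le) auto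
  also have "\<dots> \<le> (\<Sum>j\<in>(UNIV :: 'n set). (3 * L) ^ (n - 1))" by (intro sum_mono P')
  finally have "card PP \<le> ((2 * R + 1) * m) ^ d * (n * (3 * L) ^ (n - 1))"
    unfolding PP_def card_cartesian_product using P by (intro mult_mono) (auto simp: n_def)
  then have "real (card PP) \<le> real (((2 * R + 1) * m) ^ d * (n * (3 * L) ^ (n - 1)))"
    by (rule of_nat_mono)
  then have "real (card PP) * C ^ N \<le> real (((2 * R + 1) * m) ^ d * (n * (3 * L) ^ (n - 1))) * C ^ N"
    using C by (intro mult_right_mono) auto
  also have "real (((2 * R + 1) * m) ^ d * (n * (3 * L) ^ (n - 1)))
      = ((2 * real R + 1) * real m) ^ d * (real n * (3 * real L) ^ (n - 1))"
    by (simp only: of_nat_mult of_nat_power of_nat_add of_nat_numeral of_nat_1)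
  also have "\<dots> * C ^ N = A * real m ^ d * real L ^ (n - 1)"
    unfolding A_def power_mult_distrib by (simp only: mult_ac)
  also have "\<dots> < real L ^ N" by (rule L)
  finally have few: "real (card PP) * (2 * \<eta> / (h * c) + 1) ^ N < real L ^ N" by (simp add: C_eq)
  have low: "\<exists>f\<in>F. c \<le> \<bar>y f (fst p) \<bullet> snd p\<bar>" if "p \<in> PP" for p
    using that P(1) P'(1) unfolding PP_def S_def by (intro c(2)) fastforce+
  obtain s where s: "\<And>i f. i < N \<Longrightarrow> f \<in> F \<Longrightarrow> s i f < L"
    "\<And>p. p \<in> PP \<Longrightarrow> \<exists>i<N. \<eta> < \<bar>z i (fst p) \<bullet> snd p + (\<Sum>f\<in>F. h * real (s i f) * (y f (fst p) \<bullet> snd p))\<bar>"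
    by (rule exists_avoiding_combination[OF F F0 finPP low c(1) h \<eta> L(1) few,
          where z = "\<lambda>i p. z i (fst p) \<bullet> snd p"]) blast+
  define t where "t i f = h * real (s i f)" for i f
  define W where "W i x = z i x + (\<Sum>f\<in>F. t i f *\<^sub>R y f x)" for i x
  have t: "\<bar>t i f\<bar> \<le> \<epsilon>" if "i < N" "f \<in> F" for i f
    using s(1)[OF that] h \<epsilon> L unfolding t_def h_def by (simp add: abs_mult field_simps)
  have WB: "norm (W i x) \<le> B * Q" if "i < N" "x \<in> K" for i x
  proof -
    have "norm (W i x) \<le> norm (z i x) + (\<Sum>f\<in>F. norm (t i f *\<^sub>R y f x))"
      unfolding W_def by (intro order_trans[OF norm_triangle_ineq] add_left_mono norm_sum)
    also have "\<dots> \<le> B + (\<Sum>f\<in>F. \<epsilon> * B)"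
      using that t zB yB \<epsilon> by (intro add_mono sum_mono) (auto intro!: mult_mono)
    finally show ?thesis by (simp add: Q_def algebra_simps)
  qed
  have WH: "norm (W i x - W i x') \<le> H * Q * dist x x' powr \<alpha>" if "i < N" "x \<in> K" "x' \<in> K" for i x x'
  proof -
    have eq: "W i x - W i x' = (z i x - z i x') + (\<Sum>f\<in>F. t i f *\<^sub>R (y f x - y f x'))"
      by (simp add: W_def sum_subtractf scaleR_diff_right)
    have "norm (W i x - W i x') \<le> norm (z i x - z i x') + (\<Sum>f\<in>F. norm (t i f *\<^sub>R (y f x - y f x')))"
      unfolding eq by (intro order_trans[OF norm_triangle_ineq] add_left_mono norm_sum)
    also have "\<dots> \<le> H * dist x x' powr \<alpha> + (\<Sum>f\<in>F. \<epsilon> * (H * dist x x' powr \<alpha>))"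
      using that t zH yH \<epsilon> by (intro add_mono sum_mono) (auto intro!: mult_mono)
    finally show ?thesis by (simp add: Q_def algebra_simps)
  qed
  have main: "\<exists>i<N. W i x \<bullet> \<xi> \<noteq> 0" if x: "x \<in> K" and \<xi>: "\<xi> \<in> S j" for x \<xi> j
  proof -
    obtain x' where x': "x' \<in> P" "dist x x' \<le> real d / real m" using P(4)[OF x] by blast
    obtain \<xi>' where \<xi>': "\<xi>' \<in> P' j" "dist \<xi> \<xi>' \<le> real n / real L" using P'(4)[OF \<xi>] by blast
    have "(x', \<xi>') \<in> PP" using x' \<xi>' by (auto simp: PP_def)
    from s(2)[OF this] obtain i where i: "i < N" "\<eta> < \<bar>z i x' \<bullet> \<xi>' + (\<Sum>f\<in>F. h * real (s i f) * (y f x' \<bullet> \<xi>'))\<bar>"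
      by auto
    have "z i x' \<bullet> \<xi>' + (\<Sum>f\<in>F. h * real (s i f) * (y f x' \<bullet> \<xi>')) = W i x' \<bullet> \<xi>'"
      by (simp add: W_def t_def inner_add_left inner_sum_left)
    with i have big: "\<eta> < \<bar>W i x' \<bullet> \<xi>'\<bar>" by simp
    have "norm \<xi> \<le> (\<Sum>i\<in>UNIV. \<bar>\<xi> $ i\<bar>)" by (rule norm_le_l1_cart)
    also have "\<dots> \<le> (\<Sum>i\<in>(UNIV :: 'n set). 1)" using \<xi> by (intro sum_mono) (auto simp: S_def)
    finally have norm\<xi>: "norm \<xi> \<le> real n" by (simp add: n_def)
    have x'K: "x' \<in> K" using x' P by auto
    \<comment> \<open>The mesh 1/m was chosen so that its \<alpha>-th power is at most 1/L; the
      factor d powr \<alpha> is at most d because d \<ge> 1 and \<alpha> \<le> 1.\<close>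
    have "dist x x' powr \<alpha> \<le> (real d * (1 / real m)) powr \<alpha>"
      using x' \<alpha> by (intro powr_mono2) auto
    also have "\<dots> = real d powr \<alpha> * (1 / real m) powr \<alpha>" by (rule powr_mult)
    also have "\<dots> \<le> real d powr 1 * (1 / real L)"
      using L dn \<alpha> by (intro mult_mono powr_mono) simp_all
    finally have dist: "dist x x' powr \<alpha> \<le> real d / real L" using dn by simp
    \<comment> \<open>Moving x and \<xi> one after the other changes the value by at most \<eta>. At
      the net point it exceeds \<eta> in modulus, so it cannot vanish at (x, \<xi>).\<close>
    have "W i x' \<bullet> \<xi>' - W i x \<bullet> \<xi> = (W i x' - W i x) \<bullet> \<xi> + W i x' \<bullet> (\<xi>' - \<xi>)"
      by (simp add: inner_diff_left inner_diff_right)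
    then have "\<bar>W i x' \<bullet> \<xi>' - W i x \<bullet> \<xi>\<bar> \<le> \<bar>(W i x' - W i x) \<bullet> \<xi>\<bar> + \<bar>W i x' \<bullet> (\<xi>' - \<xi>)\<bar>"
      by simp
    also have "\<dots> \<le> norm (W i x' - W i x) * norm \<xi> + norm (W i x') * norm (\<xi>' - \<xi>)"
      by (intro add_mono Cauchy_Schwarz_ineq2)
    also have "\<dots> \<le> (H * Q * (real d / real L)) * real n + (B * Q) * (real n / real L)"
    proof (intro add_mono mult_mono)
      show "norm (W i x' - W i x) \<le> H * Q * (real d / real L)"
        using WH[OF i(1) x x'K] mult_left_mono[OF dist, of "H * Q"] HB Q by (simp add: norm_minus_commute)
      show "norm (\<xi>' - \<xi>) \<le> real n / real L" using \<xi>' by (simp add: dist_norm norm_minus_commute)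
    qed (use WB[OF i(1) x'K] norm\<xi> HB Q in auto)
    also have "\<dots> = \<eta>" by (simp add: \<eta>_def \<kappa>_def add_divide_distrib)
    finally have "W i x \<bullet> \<xi> \<noteq> 0" using big by auto
    then show ?thesis using i by blast
  qed
  show thesis
  proof (rule that[of t])
    show "\<bar>t i f\<bar> \<le> \<epsilon>" if "i < N" "f \<in> F" for i f by (rule t[OF that])
    fix x :: "real^'d" and \<xi> :: "real^'n" assume x: "x \<in> K" and \<xi>: "\<xi> \<noteq> 0"
    \<comment> \<open>Dividing \<xi> by its coordinate of largest modulus puts it on the face
      \<open>S j\<close>; nonvanishing is unaffected by this scaling.\<close>
    obtain j where j: "\<And>i. \<bar>\<xi> $ i\<bar> \<le> \<bar>\<xi> $ j\<bar>"
    proof -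
      have "Max (range (\<lambda>i. \<bar>\<xi> $ i\<bar>)) \<in> range (\<lambda>i. \<bar>\<xi> $ i\<bar>)" by (intro Max_in) auto
      then obtain j where j: "Max (range (\<lambda>i. \<bar>\<xi> $ i\<bar>)) = \<bar>\<xi> $ j\<bar>" by (rule rangeE)
      have "\<bar>\<xi> $ i\<bar> \<le> \<bar>\<xi> $ j\<bar>" for i unfolding j[symmetric] by (rule Max_ge) auto
      then show thesis by (rule that)
    qed
    have "\<xi> $ j \<noteq> 0" using j \<xi> by (auto simp: vec_eq_iff)
    then have "(1 / \<xi> $ j) *\<^sub>R \<xi> \<in> S j" using j by (auto simp: S_def abs_mult field_simps)
    from main[OF x this] show "\<exists>i<N. (z i x + (\<Sum>f\<in>F. t i f *\<^sub>R y f x)) \<bullet> \<xi> \<noteq> 0"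
      unfolding W_def by auto
  qed
qed

section \<open>Seminormed function spaces and their topology\<close>

text \<open>A single estimate for linear combinations replaces subadditivity and homogeneity, so
  each concrete norm needs only one argument. Definiteness is absent because functions stand for
  classes.\<close>

locale fn_seminorm =
  fixes S :: "('a \<Rightarrow> 'b::real_vector) set" and Nm :: "('a \<Rightarrow> 'b) \<Rightarrow> real"
  assumes lincomb_mem: "u \<in> S \<Longrightarrow> v \<in> S \<Longrightarrow> (\<lambda>x. r *\<^sub>R u x + s *\<^sub>R v x) \<in> S"
    and lincomb_le: "u \<in> S \<Longrightarrow> v \<in> S \<Longrightarrow>
      Nm (\<lambda>x. r *\<^sub>R u x + s *\<^sub>R v x) \<le> \<bar>r\<bar> * Nm u + \<bar>s\<bar> * Nm v"
begin

lemma zero_mem: "u \<in> S \<Longrightarrow> (\<lambda>_. 0) \<in> S"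
  using lincomb_mem[of u u 0 0] by simp

text \<open>Coefficients 0 give Nm 0 \<le> 0, and 0 = 0 + 0 gives Nm 0 \<le> 2 * Nm 0, hence the
  other inequality.\<close>

lemma zero_eq: "u \<in> S \<Longrightarrow> Nm (\<lambda>_. 0) = 0"
  using lincomb_le[of u u 0 0] lincomb_le[of "\<lambda>_. 0" "\<lambda>_. 0" 1 1] zero_mem[of u] by simp

lemma nonneg: "u \<in> S \<Longrightarrow> 0 \<le> Nm u"
  using lincomb_le[of u u 1 "-1"] zero_eq[of u] by simp

lemma diff_mem: "u \<in> S \<Longrightarrow> v \<in> S \<Longrightarrow> (\<lambda>x. u x - v x) \<in> S"
  using lincomb_mem[of u v 1 "-1"] by simp

lemma diff_triangle:
  assumes "u \<in> S" "v \<in> S" "w \<in> S"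
  shows "Nm (\<lambda>x. u x - w x) \<le> Nm (\<lambda>x. u x - v x) + Nm (\<lambda>x. v x - w x)"
  using lincomb_le[of "\<lambda>x. u x - v x" "\<lambda>x. v x - w x" 1 1] diff_mem assms by simp

lemma openin_ball:
  assumes "u \<in> S" "0 < r"
  shows "openin (norm_topology S Nm) {v\<in>S. Nm (\<lambda>x. v x - u x) < r}"
  unfolding norm_topology_def by (rule topology_generated_by_Basis) (use assms in blast)

lemma center_mem_ball: "u \<in> S \<Longrightarrow> 0 < r \<Longrightarrow> u \<in> {v\<in>S. Nm (\<lambda>x. v x - u x) < r}"
  using zero_eq by simp

text \<open>\<open>norm_topology\<close> has the balls as a subbasis, so this is proved by induction
  over the generation of open sets.\<close>

lemma openin_contains_ball:
  assumes "openin (norm_topology S Nm) U" "u \<in> U"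
  shows "\<exists>r>0. {v\<in>S. Nm (\<lambda>x. v x - u x) < r} \<subseteq> U"
proof -
  have "generate_topology_on {{v\<in>S. Nm (\<lambda>x. v x - u x) < r} | u r. u \<in> S \<and> 0 < r} U"
    using assms(1) unfolding norm_topology_def openin_topology_generated_by_iff .
  then show ?thesis using assms(2)
  proof (induction arbitrary: u)
    case Empty
    then show ?case by simp
  next
    case (Int A B)
    then obtain r s where "r > 0" "{v\<in>S. Nm (\<lambda>x. v x - u x) < r} \<subseteq> A"
      "s > 0" "{v\<in>S. Nm (\<lambda>x. v x - u x) < s} \<subseteq> B" by blast
    then show ?case by (intro exI[of _ "min r s"]) auto
  next
    case (UN K)
    then show ?case by blast
  next
    case (Basis A)
    then obtain w r where w: "w \<in> S" "0 < r" "A = {v\<in>S. Nm (\<lambda>x. v x - w x) < r}" by blast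
    with Basis have u: "u \<in> S" "Nm (\<lambda>x. u x - w x) < r" by auto
    \<comment> \<open>A generating ball may be centred elsewhere; the triangle inequality fits a
      smaller ball around u into it.\<close>
    have "{v\<in>S. Nm (\<lambda>x. v x - u x) < r - Nm (\<lambda>x. u x - w x)} \<subseteq> A"
      using diff_triangle[OF _ u(1) w(1)] w by fastforce
    then show ?case using u by (intro exI[of _ "r - Nm (\<lambda>x. u x - w x)"]) simp
  qed
qed

text \<open>The element w guarantees that S is nonempty and so contains 0, which is what the case of
  empty F requires.\<close>

lemma sum_mem_le:
  assumes "w \<in> S" "finite F" "F \<subseteq> S"
  shows "(\<lambda>x. \<Sum>f\<in>F. t f *\<^sub>R f x) \<in> S \<and> Nm (\<lambda>x. \<Sum>f\<in>F. t f *\<^sub>R f x) \<le> (\<Sum>f\<in>F. \<bar>t f\<bar> * Nm f)"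
  using assms(2,3)
proof (induction F)
  case empty
  then show ?case using zero_mem zero_eq assms(1) by simp
next
  case (insert f F)
  then show ?case
    using lincomb_mem[of f "\<lambda>x. \<Sum>f\<in>F. t f *\<^sub>R f x" "t f" 1]
      lincomb_le[of f "\<lambda>x. \<Sum>f\<in>F. t f *\<^sub>R f x" "t f" 1] by auto
qed

end

text \<open>The sup norm, the Hoelder seminorm and the H^1 norm are all infima of admissible values.
  If admissible values combine linearly, near-minimisers with slack \<delta> yield the inequality
  for the infima.\<close>

lemma Inf_lincomb_le:
  fixes A B C :: "real set"
  assumes "A \<noteq> {}" "B \<noteq> {}" "bdd_below C" "0 \<le> r" "0 \<le> s"
    and step: "\<And>a b. a \<in> A \<Longrightarrow> b \<in> B \<Longrightarrow> \<exists>c\<in>C. c \<le> r * a + s * b"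
  shows "Inf C \<le> r * Inf A + s * Inf B"
proof (rule field_le_epsilon)
  fix e :: real assume e: "0 < e"
  define \<delta> where "\<delta> = e / (r + s + 1)"
  have \<delta>: "0 < \<delta>" "(r + s) * \<delta> \<le> e"
    using assms(4,5) e by (auto simp: \<delta>_def field_simps)
  obtain a where a: "a \<in> A" "a < Inf A + \<delta>"
    using cInf_lessD[OF assms(1), of "Inf A + \<delta>"] \<delta> by auto
  obtain b where b: "b \<in> B" "b < Inf B + \<delta>"
    using cInf_lessD[OF assms(2), of "Inf B + \<delta>"] \<delta> by auto
  obtain x where "x \<in> C" "x \<le> r * a + s * b" using step[OF a(1) b(1)] by blast
  then have "Inf C \<le> r * a + s * b" using cInf_lower[OF _ assms(3)] by fastforce
  also have "\<dots> \<le> r * (Inf A + \<delta>) + s * (Inf B + \<delta>)"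
    using a b assms(4,5) by (intro add_mono mult_left_mono) auto
  also have "\<dots> \<le> r * Inf A + s * Inf B + e" using \<delta>(2) by (simp add: algebra_simps)
  finally show "Inf C \<le> r * Inf A + s * Inf B + e" .
qed

section \<open>Sup norms, Hoelder seminorms and Hoelder spaces\<close>

lemma norm_le_sup_norm:
  assumes "\<exists>M. \<forall>x\<in>S. norm (f x) \<le> M" "x \<in> S"
  shows "norm (f x) \<le> sup_norm S f"
proof -
  obtain M where "\<forall>x\<in>S. norm (f x) \<le> M" using assms by blast
  \<comment> \<open>On an empty set a bound M may be negative, whereas admissible constants are
    nonnegative.\<close>
  then have "max M 0 \<in> {M. 0 \<le> M \<and> (\<forall>x\<in>S. norm (f x) \<le> M)}" by fastforce
  then have "{M. 0 \<le> M \<and> (\<forall>x\<in>S. norm (f x) \<le> M)} \<noteq> {}" by blast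
  then show ?thesis unfolding sup_norm_def by (rule cInf_greatest) (use assms(2) in auto)
qed

text \<open>The equation for w is asked for on S only, since derivatives of a combination are
  identified only in the interior of K.\<close>

lemma sup_norm_lincomb_le:
  assumes "\<exists>M. \<forall>x\<in>S. norm (f x) \<le> M" "\<exists>M. \<forall>x\<in>S. norm (g x) \<le> M"
    and w: "\<And>x. x \<in> S \<Longrightarrow> w x = r *\<^sub>R f x + s *\<^sub>R g x"
  shows "sup_norm S w \<le> \<bar>r\<bar> * sup_norm S f + \<bar>s\<bar> * sup_norm S g"
  unfolding sup_norm_def
proof (rule Inf_lincomb_le)
  have *: "{M. 0 \<le> M \<and> (\<forall>x\<in>S. norm (f x) \<le> M)} \<noteq> {}" if "\<exists>M. \<forall>x\<in>S. norm (f x) \<le> M" for f :: "'a \<Rightarrow> 'b"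
  proof -
    from that obtain M where "\<forall>x\<in>S. norm (f x) \<le> M" by blast
    then have "max M 0 \<in> {M. 0 \<le> M \<and> (\<forall>x\<in>S. norm (f x) \<le> M)}" by fastforce
    then show ?thesis by blast
  qed
  show "{M. 0 \<le> M \<and> (\<forall>x\<in>S. norm (f x) \<le> M)} \<noteq> {}" by (rule *[OF assms(1)])
  show "{M. 0 \<le> M \<and> (\<forall>x\<in>S. norm (g x) \<le> M)} \<noteq> {}" by (rule *[OF assms(2)])
  show "bdd_below {M. 0 \<le> M \<and> (\<forall>x\<in>S. norm (w x) \<le> M)}" by (rule bdd_belowI[of _ 0]) auto
  fix a b assume a: "a \<in> {M. 0 \<le> M \<and> (\<forall>x\<in>S. norm (f x) \<le> M)}" and b: "b \<in> {M. 0 \<le> M \<and> (\<forall>x\<in>S. norm (g x) \<le> M)}"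
  have "norm (w x) \<le> \<bar>r\<bar> * a + \<bar>s\<bar> * b" if "x \<in> S" for x
  proof -
    have "norm (w x) \<le> norm (r *\<^sub>R f x) + norm (s *\<^sub>R g x)"
      unfolding w[OF that] by (rule norm_triangle_ineq)
    also have "\<dots> \<le> \<bar>r\<bar> * a + \<bar>s\<bar> * b"
      using a b that by (auto intro!: add_mono mult_left_mono)
    finally show ?thesis .
  qed
  then show "\<exists>c\<in>{M. 0 \<le> M \<and> (\<forall>x\<in>S. norm (w x) \<le> M)}. c \<le> \<bar>r\<bar> * a + \<bar>s\<bar> * b"
    using a b by (intro bexI[of _ "\<bar>r\<bar> * a + \<bar>s\<bar> * b"]) auto
qed auto

lemma holder_bound_lincomb:
  assumes f: "holder_bound \<alpha> S f a" and g: "holder_bound \<alpha> S g b"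
    and w: "\<And>x. x \<in> S \<Longrightarrow> w x = r *\<^sub>R f x + s *\<^sub>R g x"
  shows "holder_bound \<alpha> S w (\<bar>r\<bar> * a + \<bar>s\<bar> * b)"
  unfolding holder_bound_def
proof (intro conjI ballI)
  show "0 \<le> \<bar>r\<bar> * a + \<bar>s\<bar> * b" using f g by (auto simp: holder_bound_def)
  fix x y assume xy: "x \<in> S" "y \<in> S"
  have "w x - w y = r *\<^sub>R (f x - f y) + s *\<^sub>R (g x - g y)"
    using xy by (simp add: w algebra_simps)
  then have "norm (w x - w y) \<le> norm (r *\<^sub>R (f x - f y)) + norm (s *\<^sub>R (g x - g y))"
    by (simp only: norm_triangle_ineq)
  also have "\<dots> \<le> \<bar>r\<bar> * (a * dist x y powr \<alpha>) + \<bar>s\<bar> * (b * dist x y powr \<alpha>)"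
    using f g xy unfolding holder_bound_def by (auto intro!: add_mono mult_left_mono)
  finally show "norm (w x - w y) \<le> (\<bar>r\<bar> * a + \<bar>s\<bar> * b) * dist x y powr \<alpha>"
    by (simp add: algebra_simps)
qed

lemma holder_seminorm_lincomb_le:
  assumes "\<exists>M. holder_bound \<alpha> S f M" "\<exists>M. holder_bound \<alpha> S g M"
    and w: "\<And>x. x \<in> S \<Longrightarrow> w x = r *\<^sub>R f x + s *\<^sub>R g x"
  shows "holder_seminorm \<alpha> S w \<le> \<bar>r\<bar> * holder_seminorm \<alpha> S f + \<bar>s\<bar> * holder_seminorm \<alpha> S g"
  unfolding holder_seminorm_def
proof (rule Inf_lincomb_le)
  show "bdd_below {M. holder_bound \<alpha> S w M}"
    by (rule bdd_belowI[of _ 0]) (auto simp: holder_bound_def)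
  fix a b assume "a \<in> {M. holder_bound \<alpha> S f M}" "b \<in> {M. holder_bound \<alpha> S g M}"
  then have "holder_bound \<alpha> S w (\<bar>r\<bar> * a + \<bar>s\<bar> * b)"
    using holder_bound_lincomb[of \<alpha> S f a g b w r s] w by auto
  then show "\<exists>c\<in>{M. holder_bound \<alpha> S w M}. c \<le> \<bar>r\<bar> * a + \<bar>s\<bar> * b" by auto
qed (use assms in auto)

lemma holder_seminorm_nonneg:
  assumes "\<exists>M. holder_bound \<alpha> S f M"
  shows "0 \<le> holder_seminorm \<alpha> S f"
  unfolding holder_seminorm_def using assms by (intro cInf_greatest) (auto simp: holder_bound_def)

text \<open>By induction the identity for the shorter word holds on the whole open set U and may
  therefore be differentiated at x. Differentiability below order k suffices, as a word of length k
  differentiates derivatives of order k - 1.\<close>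

lemma iter_pderiv_lincomb:
  fixes u v :: "'a::euclidean_space \<Rightarrow> 'b::real_normed_vector"
  assumes U: "open U"
    and u: "\<forall>es. set es \<subseteq> Basis \<and> length es < k \<longrightarrow> (\<forall>x\<in>U. iter_pderiv es u differentiable (at x))"
    and v: "\<forall>es. set es \<subseteq> Basis \<and> length es < k \<longrightarrow> (\<forall>x\<in>U. iter_pderiv es v differentiable (at x))"
    and "set es \<subseteq> Basis" "length es \<le> k" "x \<in> U"
  shows "iter_pderiv es (\<lambda>x. r *\<^sub>R u x + s *\<^sub>R v x) x = r *\<^sub>R iter_pderiv es u x + s *\<^sub>R iter_pderiv es v x"
  using assms(4-6)
proof (induction es arbitrary: x)
  case Nil
  then show ?case by simp
next
  case (Cons e es)
  let ?w = "\<lambda>x. r *\<^sub>R u x + s *\<^sub>R v x"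
  have "((\<lambda>y. r *\<^sub>R iter_pderiv es u y + s *\<^sub>R iter_pderiv es v y) has_derivative
      (\<lambda>h. r *\<^sub>R frechet_derivative (iter_pderiv es u) (at x) h + s *\<^sub>R frechet_derivative (iter_pderiv es v) (at x) h)) (at x)"
    using u[rule_format, of es x] v[rule_format, of es x] Cons.prems
    by (intro has_derivative_add has_derivative_scaleR_right) (auto simp: frechet_derivative_works)
  then have "(iter_pderiv es ?w has_derivative
      (\<lambda>h. r *\<^sub>R frechet_derivative (iter_pderiv es u) (at x) h + s *\<^sub>R frechet_derivative (iter_pderiv es v) (at x) h)) (at x)"
    by (rule has_derivative_transform_within_open[OF _ U \<open>x \<in> U\<close>]) (use Cons in auto)
  from frechet_derivative_at[OF this] show ?case by (auto simp: fun_eq_iff)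
qed

lemma iter_pderiv_lincomb_differentiable:
  fixes u v :: "'a::euclidean_space \<Rightarrow> 'b::real_normed_vector"
  assumes U: "open U"
    and u: "\<forall>es. set es \<subseteq> Basis \<and> length es < k \<longrightarrow> (\<forall>x\<in>U. iter_pderiv es u differentiable (at x))"
    and v: "\<forall>es. set es \<subseteq> Basis \<and> length es < k \<longrightarrow> (\<forall>x\<in>U. iter_pderiv es v differentiable (at x))"
    and "set es \<subseteq> Basis" "length es < k" "x \<in> U"
  shows "iter_pderiv es (\<lambda>x. r *\<^sub>R u x + s *\<^sub>R v x) differentiable (at x)"
proof -
  have "(\<lambda>y. r *\<^sub>R iter_pderiv es u y + s *\<^sub>R iter_pderiv es v y) differentiable (at x)"
    using u[rule_format, of es x] v[rule_format, of es x] assms(4-6) by (intro differentiable_add differentiable_scaleR) auto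
  then obtain D where "((\<lambda>y. r *\<^sub>R iter_pderiv es u y + s *\<^sub>R iter_pderiv es v y) has_derivative D) (at x)"
    by (auto simp: differentiable_def)
  then have "(iter_pderiv es (\<lambda>x. r *\<^sub>R u x + s *\<^sub>R v x) has_derivative D) (at x)"
    by (rule has_derivative_transform_within_open[OF _ U \<open>x \<in> U\<close>])
      (use assms iter_pderiv_lincomb[OF U u v, where es = es and r = r and s = s] in auto)
  then show ?thesis by (auto simp: differentiable_def)
qed

lemma holder_space_pderiv_extends:
  assumes "u \<in> holder_space k \<alpha> K" "set es \<subseteq> Basis" "length es \<le> k"
  obtains g where "continuous_on K g" "\<And>x. x \<in> interior K \<Longrightarrow> g x = iter_pderiv es u x"
proof -
  have "\<forall>es. set es \<subseteq> Basis \<and> length es \<le> k \<longrightarrow>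
      (\<exists>g. continuous_on K g \<and> (\<forall>x\<in>interior K. g x = iter_pderiv es u x))"
    using assms(1) unfolding holder_space_def mem_Collect_eq by (elim conjE)
  from this[rule_format, OF conjI, OF assms(2,3)] show thesis using that by blast
qed

lemma holder_space_pderiv_holder:
  assumes "u \<in> holder_space k \<alpha> K" "set es \<subseteq> Basis" "length es = k"
  shows "\<exists>M. holder_bound \<alpha> (interior K) (iter_pderiv es u) M"
proof -
  have "\<forall>es. set es \<subseteq> Basis \<and> length es = k \<longrightarrow> (\<exists>M. holder_bound \<alpha> (interior K) (iter_pderiv es u) M)"
    using assms(1) unfolding holder_space_def mem_Collect_eq by (elim conjE)
  from this[rule_format, OF conjI, OF assms(2,3)] show ?thesis .
qed

lemma holder_space_pderiv_bounded:
  assumes "compact K" "u \<in> holder_space k \<alpha> K" "set es \<subseteq> Basis" "length es \<le> k"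
  shows "\<exists>M. \<forall>x\<in>interior K. norm (iter_pderiv es u x) \<le> M"
proof -
  obtain g where g: "continuous_on K g" "\<And>x. x \<in> interior K \<Longrightarrow> g x = iter_pderiv es u x"
    using holder_space_pderiv_extends[OF assms(2-4)] by blast
  have "bounded (g ` K)" using g assms by (intro compact_imp_bounded compact_continuous_image)
  then obtain M where "\<forall>x\<in>K. norm (g x) \<le> M" by (auto simp: bounded_iff)
  then show ?thesis using g interior_subset by (metis subsetD)
qed

text \<open>Compactness of K bounds the continuous extensions of the derivatives. Hence the infima
  defining the sup norms range over nonempty sets and obey the linear estimate.\<close>

lemma fn_seminorm_holder:
  fixes K :: "'a::euclidean_space set"
  assumes K: "compact K"
  shows "fn_seminorm (holder_space k \<alpha> K :: ('a \<Rightarrow> 'b::real_normed_vector) set) (holder_norm k \<alpha> K)"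
proof
  fix u v :: "'a \<Rightarrow> 'b" and r s :: real
  assume u: "u \<in> holder_space k \<alpha> K" and v: "v \<in> holder_space k \<alpha> K"
  let ?w = "\<lambda>x. r *\<^sub>R u x + s *\<^sub>R v x"
  have du: "\<forall>es. set es \<subseteq> Basis \<and> length es < k \<longrightarrow> (\<forall>x\<in>interior K. iter_pderiv es u differentiable (at x))"
    using u by (auto simp: holder_space_def)
  have dv: "\<forall>es. set es \<subseteq> Basis \<and> length es < k \<longrightarrow> (\<forall>x\<in>interior K. iter_pderiv es v differentiable (at x))"
    using v by (auto simp: holder_space_def)
  note eq = iter_pderiv_lincomb[OF open_interior du dv, where r = r and s = s]
  show "?w \<in> holder_space k \<alpha> K"
    unfolding holder_space_def
  proof (safe)
    have "continuous_on K u" "continuous_on K v" using u v by (auto simp: holder_space_def)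
    then show "continuous_on K ?w" by (intro continuous_intros)
  next
    fix es x assume "set es \<subseteq> (Basis :: 'a set)" "length es < k" "x \<in> interior K"
    then show "iter_pderiv es ?w differentiable (at x)"
      by (intro iter_pderiv_lincomb_differentiable[OF open_interior du dv])
  next
    fix es assume es: "set es \<subseteq> (Basis :: 'a set)" "length es \<le> k"
    obtain g where g: "continuous_on K g" "\<And>x. x \<in> interior K \<Longrightarrow> g x = iter_pderiv es u x"
      using holder_space_pderiv_extends[OF u es] by blast
    obtain g' where g': "continuous_on K g'" "\<And>x. x \<in> interior K \<Longrightarrow> g' x = iter_pderiv es v x"
      using holder_space_pderiv_extends[OF v es] by blast
    show "\<exists>g. continuous_on K g \<and> (\<forall>x\<in>interior K. g x = iter_pderiv es ?w x)"
    proof (intro exI conjI ballI)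
      show "continuous_on K (\<lambda>x. r *\<^sub>R g x + s *\<^sub>R g' x)" by (intro continuous_intros g g')
      show "r *\<^sub>R g x + s *\<^sub>R g' x = iter_pderiv es ?w x" if "x \<in> interior K" for x
        using eq[OF es that] g g' that by simp
    qed
  next
    fix es assume es: "set es \<subseteq> (Basis :: 'a set)" "k = length es"
    obtain M where M: "holder_bound \<alpha> (interior K) (iter_pderiv es u) M"
      using holder_space_pderiv_holder[OF u es(1)] es(2) by metis
    obtain M' where M': "holder_bound \<alpha> (interior K) (iter_pderiv es v) M'"
      using holder_space_pderiv_holder[OF v es(1)] es(2) by metis
    show "\<exists>M. holder_bound \<alpha> (interior K) (iter_pderiv es ?w) M"
      by (rule exI, rule holder_bound_lincomb[OF M M'], rule eq) (use es in auto)
  qed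
  have sup: "sup_norm (interior K) (iter_pderiv es ?w) \<le>
      \<bar>r\<bar> * sup_norm (interior K) (iter_pderiv es u) + \<bar>s\<bar> * sup_norm (interior K) (iter_pderiv es v)"
    if "set es \<subseteq> Basis" "length es \<le> k" for es
  proof (rule sup_norm_lincomb_le)
    show "\<exists>M. \<forall>x\<in>interior K. norm (iter_pderiv es u x) \<le> M"
      by (rule holder_space_pderiv_bounded[OF K u that])
    show "\<exists>M. \<forall>x\<in>interior K. norm (iter_pderiv es v x) \<le> M"
      by (rule holder_space_pderiv_bounded[OF K v that])
    show "iter_pderiv es ?w x = r *\<^sub>R iter_pderiv es u x + s *\<^sub>R iter_pderiv es v x" if "x \<in> interior K" for x
      by (rule eq) fact+
  qed
  have semi: "holder_seminorm \<alpha> (interior K) (iter_pderiv es ?w) \<le>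
      \<bar>r\<bar> * holder_seminorm \<alpha> (interior K) (iter_pderiv es u) + \<bar>s\<bar> * holder_seminorm \<alpha> (interior K) (iter_pderiv es v)"
    if "set es \<subseteq> Basis" "length es = k" for es
  proof (rule holder_seminorm_lincomb_le)
    show "\<exists>M. holder_bound \<alpha> (interior K) (iter_pderiv es u) M"
      "\<exists>M. holder_bound \<alpha> (interior K) (iter_pderiv es v) M"
      by (rule holder_space_pderiv_holder[OF u that] holder_space_pderiv_holder[OF v that])+
    show "iter_pderiv es ?w x = r *\<^sub>R iter_pderiv es u x + s *\<^sub>R iter_pderiv es v x" if "x \<in> interior K" for x
      by (rule eq) (use \<open>set es \<subseteq> Basis\<close> \<open>length es = k\<close> that in simp_all)
  qed
  have "holder_norm k \<alpha> K ?w \<le>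
     (\<Sum>es | set es \<subseteq> Basis \<and> length es \<le> k. \<bar>r\<bar> * sup_norm (interior K) (iter_pderiv es u) + \<bar>s\<bar> * sup_norm (interior K) (iter_pderiv es v)) +
     (\<Sum>es | set es \<subseteq> Basis \<and> length es = k. \<bar>r\<bar> * holder_seminorm \<alpha> (interior K) (iter_pderiv es u) + \<bar>s\<bar> * holder_seminorm \<alpha> (interior K) (iter_pderiv es v))"
    unfolding holder_norm_def by (intro add_mono sum_mono) (use sup semi in auto)
  also have "\<dots> = \<bar>r\<bar> * holder_norm k \<alpha> K u + \<bar>s\<bar> * holder_norm k \<alpha> K v"
    by (simp add: holder_norm_def sum.distrib sum_distrib_left[symmetric] algebra_simps)
  finally show "holder_norm k \<alpha> K ?w \<le> \<bar>r\<bar> * holder_norm k \<alpha> K u + \<bar>s\<bar> * holder_norm k \<alpha> K v" .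
qed

text \<open>The Hoelder norm sees the interior only; density of the interior and continuity on K
  carry the bound to boundary points.\<close>

lemma norm_le_holder_norm_0:
  fixes f :: "'a::euclidean_space \<Rightarrow> 'b::real_normed_vector"
  assumes K: "compact K" "K = closure (interior K)" and f: "f \<in> holder_space 0 \<alpha> K" and x: "x \<in> K"
  shows "norm (f x) \<le> holder_norm 0 \<alpha> K f"
proof -
  have set: "{es :: 'a list. set es \<subseteq> Basis \<and> es = []} = {[]}" by auto
  have "\<exists>M. holder_bound \<alpha> (interior K) f M"
    using holder_space_pderiv_holder[OF f, of "[]"] by auto
  then have semi: "0 \<le> holder_seminorm \<alpha> (interior K) f" by (rule holder_seminorm_nonneg)
  have "norm (f y) \<le> holder_norm 0 \<alpha> K f" if "y \<in> interior K" for y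
    using norm_le_sup_norm[OF _ that, of f] holder_space_pderiv_bounded[OF K(1) f, of "[]"] semi
    by (simp add: holder_norm_def set)
  moreover have "continuous_on (closure (interior K)) f"
    using f K(2) by (simp add: holder_space_def)
  ultimately show ?thesis
    using continuous_on_closure_norm_le x K(2) by metis
qed

text \<open>The Hoelder inequality is a closed condition on pairs, and pairs of interior points are
  dense in K \<times> K. The constant M is therefore the same on K.\<close>

lemma holder_space_0_bound:
  fixes f :: "'a::euclidean_space \<Rightarrow> 'b::real_normed_vector"
  assumes K: "K = closure (interior K)" and \<alpha>: "0 < \<alpha>" and f: "f \<in> holder_space 0 \<alpha> K"
  shows "\<exists>M. holder_bound \<alpha> K f M"
proof -
  obtain M where M: "holder_bound \<alpha> (interior K) f M"
    using holder_space_pderiv_holder[OF f, of "[]"] by auto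
  define g where "g p = M * dist (fst p) (snd p) powr \<alpha> - norm (f (fst p) - f (snd p))" for p
  have f': "continuous_on K f" using f by (simp add: holder_space_def)
  have cont: "continuous_on (K \<times> K) g"
    unfolding g_def using \<alpha>
    by (intro continuous_intros continuous_on_powr' continuous_on_compose2[OF f']) auto
  have "closure (interior K \<times> interior K) = K \<times> K"
    unfolding closure_Times using K by simp
  then have "0 \<le> g p" if "p \<in> K \<times> K" for p
    using continuous_ge_on_closure[of "interior K \<times> interior K" g p 0] cont M that
    by (auto simp: g_def holder_bound_def)
  then show ?thesis using M
    by (intro exI[of _ M]) (force simp: g_def holder_bound_def)
qed

section \<open>Sobolev spaces and weak solutions\<close>

text \<open>The infimum over \<open>t\<close> of the right-hand side is attained at \<open>t = B / A\<close> if \<open>A, B > 0\<close>.\<close>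

lemma le_square_sum_if_young:
  fixes X A B :: real
  assumes AB: "0 \<le> A" "0 \<le> B"
    and X: "\<And>t. 0 < t \<Longrightarrow> X \<le> (1 + t) * A\<^sup>2 + (1 + 1 / t) * B\<^sup>2"
  shows "X \<le> (A + B)\<^sup>2"
proof (rule field_le_epsilon)
  fix e :: real assume e: "0 < e"
  define d where "d = e / (A + B + 1)"
  have d: "0 < d" and de: "d * (A + B) \<le> e" using AB e by (auto simp: d_def field_simps)
  define t where "t = (B + d) / (A + d)"
  have t: "0 < t" using AB d by (simp add: t_def)
  have "t * A \<le> B + d"
    unfolding t_def using AB d by (simp add: pos_divide_le_eq mult_left_mono)
  then have 1: "t * A * A \<le> (B + d) * A" using AB by (intro mult_right_mono)
  have "1 / t * B \<le> A + d"
    unfolding t_def using AB d by (simp add: pos_divide_le_eq mult_left_mono)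
  then have 2: "1 / t * B * B \<le> (A + d) * B" using AB by (intro mult_right_mono)
  have "X \<le> (1 + t) * A\<^sup>2 + (1 + 1 / t) * B\<^sup>2" by (rule X[OF t])
  also have "\<dots> = A * A + t * A * A + B * B + 1 / t * B * B"
    by (simp add: power2_eq_square distrib_right)
  also have "\<dots> \<le> A * A + (B + d) * A + B * B + (A + d) * B" using 1 2 by linarith
  also have "\<dots> = (A + B)\<^sup>2 + d * (A + B)" by (simp add: power2_eq_square algebra_simps)
  finally show "X \<le> (A + B)\<^sup>2 + e" using de by linarith
qed

text \<open>This is Minkowski's inequality. Young's inequality with a parameter t holds pointwise
  and can be integrated; optimising over t afterwards recovers the square of the sum of the
  norms.\<close>

lemma L2_lincomb_square_integrable:
  fixes f g :: "'a \<Rightarrow> 'b::euclidean_space"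
  assumes [measurable]: "f \<in> borel_measurable M" "g \<in> borel_measurable M"
    and f: "integrable M (\<lambda>x. (norm (f x))\<^sup>2)" and g: "integrable M (\<lambda>x. (norm (g x))\<^sup>2)"
  shows "integrable M (\<lambda>x. (norm (r *\<^sub>R f x + s *\<^sub>R g x))\<^sup>2)"
    and "sqrt (LINT x|M. (norm (r *\<^sub>R f x + s *\<^sub>R g x))\<^sup>2)
      \<le> \<bar>r\<bar> * sqrt (LINT x|M. (norm (f x))\<^sup>2) + \<bar>s\<bar> * sqrt (LINT x|M. (norm (g x))\<^sup>2)"
proof -
  let ?w = "\<lambda>x. r *\<^sub>R f x + s *\<^sub>R g x"
  have young: "(norm (?w x))\<^sup>2 \<le> (1 + t) * r\<^sup>2 * (norm (f x))\<^sup>2 + (1 + 1 / t) * s\<^sup>2 * (norm (g x))\<^sup>2"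
    if t: "0 < t" for t x
  proof -
    define a where "a = \<bar>r\<bar> * norm (f x)"
    define b where "b = \<bar>s\<bar> * norm (g x)"
    have "norm (?w x) \<le> a + b"
      unfolding a_def b_def by (rule order_trans[OF norm_triangle_ineq]) simp
    then have "(norm (?w x))\<^sup>2 \<le> (a + b)\<^sup>2" by (intro power_mono) auto
    also have "\<dots> \<le> (1 + t) * a\<^sup>2 + (1 + 1 / t) * b\<^sup>2"
    proof -
      have "0 \<le> (t * a - b)\<^sup>2 / t" using t by simp
      also have "(t * a - b)\<^sup>2 / t = t * a\<^sup>2 - 2 * a * b + b\<^sup>2 / t"
        using t by (simp add: power2_eq_square field_simps)
      finally show ?thesis by (simp add: power2_eq_square algebra_simps)
    qed
    finally show ?thesis by (simp add: a_def b_def power_mult_distrib)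
  qed
  have int: "integrable M (\<lambda>x. (1 + t) * r\<^sup>2 * (norm (f x))\<^sup>2 + (1 + 1 / t) * s\<^sup>2 * (norm (g x))\<^sup>2)" for t
    using f g by (intro Bochner_Integration.integrable_add integrable_mult_right)
  show w: "integrable M (\<lambda>x. (norm (?w x))\<^sup>2)"
  proof (rule Bochner_Integration.integrable_bound[OF int[of 1]])
    show "AE x in M. norm ((norm (?w x))\<^sup>2) \<le> norm ((1 + 1) * r\<^sup>2 * (norm (f x))\<^sup>2 + (1 + 1 / 1) * s\<^sup>2 * (norm (g x))\<^sup>2)"
      using young[of 1] by (intro AE_I2) (auto intro!: order_trans[OF _ abs_ge_self])
  qed measurable
  define X where "X = (LINT x|M. (norm (?w x))\<^sup>2)"
  define A where "A = \<bar>r\<bar> * sqrt (LINT x|M. (norm (f x))\<^sup>2)"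
  define B where "B = \<bar>s\<bar> * sqrt (LINT x|M. (norm (g x))\<^sup>2)"
  have AB: "0 \<le> A" "0 \<le> B" by (auto simp: A_def B_def)
  have X: "X \<le> (1 + t) * A\<^sup>2 + (1 + 1 / t) * B\<^sup>2" if t: "0 < t" for t
  proof -
    have "X \<le> (LINT x|M. (1 + t) * r\<^sup>2 * (norm (f x))\<^sup>2 + (1 + 1 / t) * s\<^sup>2 * (norm (g x))\<^sup>2)"
      unfolding X_def by (intro integral_mono w int young[OF t])
    also have "\<dots> = (1 + t) * r\<^sup>2 * (LINT x|M. (norm (f x))\<^sup>2) + (1 + 1 / t) * s\<^sup>2 * (LINT x|M. (norm (g x))\<^sup>2)"
      using f g by simp
    finally show ?thesis by (simp add: A_def B_def power_mult_distrib algebra_simps)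
  qed
  have "X \<le> (A + B)\<^sup>2" by (rule le_square_sum_if_young[OF AB X])
  then show "sqrt (LINT x|M. (norm (?w x))\<^sup>2)
      \<le> \<bar>r\<bar> * sqrt (LINT x|M. (norm (f x))\<^sup>2) + \<bar>s\<bar> * sqrt (LINT x|M. (norm (g x))\<^sup>2)"
    unfolding X_def[symmetric] A_def[symmetric] B_def[symmetric] using AB by (intro real_le_lsqrt) auto
qed

lemma L2_space_lincomb:
  assumes "f \<in> L2_space \<Omega>" "g \<in> L2_space \<Omega>"
  shows "(\<lambda>x. r *\<^sub>R f x + s *\<^sub>R g x) \<in> L2_space \<Omega>"
proof -
  have [measurable]: "f \<in> borel_measurable (lebesgue_on \<Omega>)" "g \<in> borel_measurable (lebesgue_on \<Omega>)"
    and int: "integrable (lebesgue_on \<Omega>) (\<lambda>x. (norm (f x))\<^sup>2)" "integrable (lebesgue_on \<Omega>) (\<lambda>x. (norm (g x))\<^sup>2)"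
    using assms by (simp_all add: L2_space_def)
  show ?thesis
    unfolding L2_space_def mem_Collect_eq
    by (intro conjI L2_lincomb_square_integrable(1) int) measurable
qed

text \<open>A bounded set has finite measure, and a \<le> 1 + a^2 dominates the function.\<close>

lemma L2_integrable:
  assumes "bounded \<Omega>" "open \<Omega>" and f: "f \<in> L2_space \<Omega>"
  shows "integrable (lebesgue_on \<Omega>) f"
proof -
  have "\<Omega> \<in> lmeasurable" using assms by (intro bounded_set_imp_lmeasurable) auto
  then interpret finite_measure "lebesgue_on \<Omega>" by (rule finite_measure_lebesgue_on)
  have "integrable (lebesgue_on \<Omega>) (\<lambda>x. 1 + (norm (f x))\<^sup>2)"
    using f by (intro Bochner_Integration.integrable_add) (auto simp: L2_space_def)
  then show ?thesis
  proof (rule Bochner_Integration.integrable_bound)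
    show "f \<in> borel_measurable (lebesgue_on \<Omega>)" using f by (simp add: L2_space_def)
    have "a \<le> 1 + a\<^sup>2" if "0 \<le> a" for a :: real
      using zero_le_power2[of "a - 1"] that by (simp add: power2_eq_square algebra_simps)
    then show "AE x in lebesgue_on \<Omega>. norm (f x) \<le> norm (1 + (norm (f x))\<^sup>2)"
      by (intro AE_I2) (auto intro!: order_trans[OF _ abs_ge_self])
  qed
qed

section \<open>Test functions, weak derivatives and the H^1 norm\<close>

lemma locally_integrable_lincomb:
  assumes "locally_integrable \<Omega> u" "locally_integrable \<Omega> v"
  shows "locally_integrable \<Omega> (\<lambda>x. r *\<^sub>R u x + s *\<^sub>R v x)"
  unfolding locally_integrable_def
proof (intro allI impI)
  fix C assume "compact C \<and> C \<subseteq> \<Omega>"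
  then have "u absolutely_integrable_on C" "v absolutely_integrable_on C"
    using assms by (simp_all add: locally_integrable_def)
  then show "(\<lambda>x. r *\<^sub>R u x + s *\<^sub>R v x) absolutely_integrable_on C"
    by (intro set_integral_add(1) absolutely_integrable_scaleR_left)
qed

lemma iter_pderiv_eq_0:
  assumes "open U" "\<And>x. x \<in> U \<Longrightarrow> \<phi> x = 0" "x \<in> U"
  shows "iter_pderiv es \<phi> x = 0"
  using assms(3)
proof (induction es arbitrary: x)
  case Nil
  then show ?case using assms by simp
next
  case (Cons e es)
  have "((\<lambda>_. 0) has_derivative (\<lambda>_. 0)) (at x)" by simp
  then have "(iter_pderiv es \<phi> has_derivative (\<lambda>_. 0)) (at x)"
    by (rule has_derivative_transform_within_open[OF _ assms(1) Cons.prems]) (use Cons in auto)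
  from frechet_derivative_at[OF this] show ?case by (auto simp: fun_eq_iff)
qed

lemma test_function_pderiv:
  fixes \<Omega> :: "'a::euclidean_space set"
  assumes "\<phi> \<in> test_functions \<Omega>"
  obtains C where "compact C" "C \<subseteq> \<Omega>"
    "\<And>es. set es \<subseteq> Basis \<Longrightarrow> continuous_on UNIV (iter_pderiv es \<phi>)"
    "\<And>es x. x \<notin> C \<Longrightarrow> iter_pderiv es \<phi> x = 0"
proof -
  obtain C where C: "compact C" "C \<subseteq> \<Omega>" "\<forall>x. x \<notin> C \<longrightarrow> \<phi> x = 0"
    and s: "smooth_on UNIV \<phi>" using assms unfolding test_functions_def by blast
  show thesis
  proof (rule that[OF C(1,2)])
    fix es :: "'a list" assume "set es \<subseteq> Basis"
    then show "continuous_on UNIV (iter_pderiv es \<phi>)"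
      using s unfolding smooth_on_def
      by (intro continuous_at_imp_continuous_on ballI differentiable_imp_continuous_within) auto
  next
    fix es x assume "x \<notin> C"
    then show "iter_pderiv es \<phi> x = 0"
      using C by (intro iter_pderiv_eq_0[of "- C"]) (auto simp: compact_imp_closed)
  qed
qed

lemma compactly_supported_bounded:
  fixes \<psi> :: "'a::metric_space \<Rightarrow> 'b::real_normed_vector"
  assumes "compact C" "continuous_on UNIV \<psi>" "\<And>x. x \<notin> C \<Longrightarrow> \<psi> x = 0"
  obtains B where "0 \<le> B" "\<And>x. norm (\<psi> x) \<le> B"
proof -
  have "bounded (\<psi> ` C)"
    using assms(1) continuous_on_subset[OF assms(2)]
    by (intro compact_imp_bounded compact_continuous_image) auto
  then obtain B where "\<forall>x\<in>C. norm (\<psi> x) \<le> B" by (auto simp: bounded_iff)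
  then have "norm (\<psi> x) \<le> max B 0" for x using assms(3)[of x] by (cases "x \<in> C") auto
  then show thesis by (intro that[of "max B 0"]) auto
qed

text \<open>Local integrability controls u only on compact sets, so u is cut off to the support C.
  There it is integrable, and the continuous factor is bounded.\<close>

lemma integrable_test_mult:
  fixes \<Omega> :: "'a::euclidean_space set" and u :: "'a \<Rightarrow> 'b::euclidean_space"
  assumes \<Omega>: "open \<Omega>" and C: "compact C" "C \<subseteq> \<Omega>" and \<psi>: "continuous_on UNIV \<psi>" "\<And>x. x \<notin> C \<Longrightarrow> \<psi> x = 0"
    and u: "locally_integrable \<Omega> u"
  shows "integrable (lebesgue_on \<Omega>) (\<lambda>x. \<psi> x *\<^sub>R u x)"
proof -
  define h where "h x = indicator C x *\<^sub>R u x" for x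
  have h: "integrable lebesgue h"
    using u C unfolding locally_integrable_def set_integrable_def h_def by blast
  obtain B where B: "0 \<le> B" "\<And>x. norm (\<psi> x) \<le> B"
    using compactly_supported_bounded[OF C(1) \<psi>] by blast
  have \<psi>m: "\<psi> \<in> borel_measurable lebesgue"
    using continuous_imp_measurable_on_sets_lebesgue[OF \<psi>(1)] by (simp add: lebesgue_on_UNIV_eq)
  have "integrable lebesgue (\<lambda>x. \<psi> x *\<^sub>R h x)"
  proof (rule Bochner_Integration.integrable_bound[where f = "\<lambda>x. B *\<^sub>R h x"])
    show "integrable lebesgue (\<lambda>x. B *\<^sub>R h x)" using h by simp
    show "(\<lambda>x. \<psi> x *\<^sub>R h x) \<in> borel_measurable lebesgue"
      using \<psi>m h by (intro borel_measurable_scaleR) auto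
    show "AE x in lebesgue. norm (\<psi> x *\<^sub>R h x) \<le> norm (B *\<^sub>R h x)"
      using B by (intro AE_I2) (auto intro!: mult_right_mono)
  qed
  moreover have "\<psi> x *\<^sub>R h x = indicator \<Omega> x *\<^sub>R (\<psi> x *\<^sub>R u x)" for x
    using C(2) \<psi>(2)[of x] by (auto simp: h_def indicator_def)
  ultimately show ?thesis using \<Omega> by (simp add: integrable_restrict_space)
qed

text \<open>The Bochner integral is additive only on integrable functions; compact support of the
  test function provides this on both sides of the defining identity.\<close>

lemma weak_pderiv_lincomb:
  fixes \<Omega> :: "'a::euclidean_space set"
  assumes \<Omega>: "open \<Omega>" and es: "set es \<subseteq> Basis"
    and u: "weak_pderiv \<Omega> es u g" and v: "weak_pderiv \<Omega> es v h"
  shows "weak_pderiv \<Omega> es (\<lambda>x. r *\<^sub>R u x + s *\<^sub>R v x) (\<lambda>x. r *\<^sub>R g x + s *\<^sub>R h x)"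
  unfolding weak_pderiv_def
proof (intro conjI ballI)
  note loc = u[unfolded weak_pderiv_def, THEN conjunct1] u[unfolded weak_pderiv_def, THEN conjunct2, THEN conjunct1]
     v[unfolded weak_pderiv_def, THEN conjunct1] v[unfolded weak_pderiv_def, THEN conjunct2, THEN conjunct1]
  show "locally_integrable \<Omega> (\<lambda>x. r *\<^sub>R u x + s *\<^sub>R v x)" "locally_integrable \<Omega> (\<lambda>x. r *\<^sub>R g x + s *\<^sub>R h x)"
    by (intro locally_integrable_lincomb loc)+
  fix \<phi> assume \<phi>: "\<phi> \<in> test_functions \<Omega>"
  obtain C where C: "compact C" "C \<subseteq> \<Omega>"
    "\<And>es. set es \<subseteq> Basis \<Longrightarrow> continuous_on UNIV (iter_pderiv es \<phi>)"
    "\<And>es x. x \<notin> C \<Longrightarrow> iter_pderiv es \<phi> x = 0" using test_function_pderiv[OF \<phi>] by blast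
  have int: "integrable (lebesgue_on \<Omega>) (\<lambda>x. iter_pderiv es' \<phi> x *\<^sub>R f x)"
    if "locally_integrable \<Omega> f" "set es' \<subseteq> Basis" for f es'
    using integrable_test_mult[OF \<Omega> C(1,2) C(3)[OF that(2)] C(4)[of _ es'] that(1)] by blast
  have lin: "(LINT x|lebesgue_on \<Omega>. iter_pderiv es' \<phi> x *\<^sub>R (r *\<^sub>R f x + s *\<^sub>R f' x)) =
      r *\<^sub>R (LINT x|lebesgue_on \<Omega>. iter_pderiv es' \<phi> x *\<^sub>R f x) + s *\<^sub>R (LINT x|lebesgue_on \<Omega>. iter_pderiv es' \<phi> x *\<^sub>R f' x)"
    if "locally_integrable \<Omega> f" "locally_integrable \<Omega> f'" "set es' \<subseteq> Basis" for f f' es'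
  proof -
    have eq: "(\<lambda>x. iter_pderiv es' \<phi> x *\<^sub>R (r *\<^sub>R f x + s *\<^sub>R f' x)) =
       (\<lambda>x. r *\<^sub>R (iter_pderiv es' \<phi> x *\<^sub>R f x) + s *\<^sub>R (iter_pderiv es' \<phi> x *\<^sub>R f' x))"
      by (simp add: scaleR_add_right mult.commute)
    show ?thesis unfolding eq using int[OF that(1,3)] int[OF that(2,3)] by (simp del: scaleR_scaleR)
  qed
  have eqs: "(LINT x|lebesgue_on \<Omega>. iter_pderiv es \<phi> x *\<^sub>R u x) = (-1) ^ length es *\<^sub>R (LINT x|lebesgue_on \<Omega>. \<phi> x *\<^sub>R g x)"
    "(LINT x|lebesgue_on \<Omega>. iter_pderiv es \<phi> x *\<^sub>R v x) = (-1) ^ length es *\<^sub>R (LINT x|lebesgue_on \<Omega>. \<phi> x *\<^sub>R h x)"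
    using u v \<phi> by (auto simp: weak_pderiv_def)
  show "(LINT x|lebesgue_on \<Omega>. iter_pderiv es \<phi> x *\<^sub>R (r *\<^sub>R u x + s *\<^sub>R v x)) =
        (-1) ^ length es *\<^sub>R (LINT x|lebesgue_on \<Omega>. \<phi> x *\<^sub>R (r *\<^sub>R g x + s *\<^sub>R h x))"
    \<comment> \<open>The empty word gives the test function itself, so \<open>lin\<close> serves
      the right-hand side too.\<close>
    using lin[OF loc(1,3) es] lin[OF loc(2,4), of "[]"] eqs by (simp add: scaleR_add_right mult.commute)
qed

lemma weak_gradient_lincomb:
  assumes \<Omega>: "open \<Omega>" and u: "weak_gradient \<Omega> u G" and v: "weak_gradient \<Omega> v G'"
  shows "weak_gradient \<Omega> (\<lambda>x. r *\<^sub>R u x + s *\<^sub>R v x) (\<lambda>x. r *\<^sub>R G x + s *\<^sub>R G' x)"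
  unfolding weak_gradient_def
proof (intro conjI ballI)
  show "(\<lambda>x. r *\<^sub>R G x + s *\<^sub>R G' x) \<in> L2_space \<Omega>"
    using u v by (intro L2_space_lincomb) (auto simp: weak_gradient_def)
  fix e :: 'a assume e: "e \<in> Basis"
  then have "weak_pderiv \<Omega> [e] u (\<lambda>x. G x \<bullet> e)" "weak_pderiv \<Omega> [e] v (\<lambda>x. G' x \<bullet> e)"
    using u v by (auto simp: weak_gradient_def)
  from weak_pderiv_lincomb[OF \<Omega> _ this, of r s] e
  show "weak_pderiv \<Omega> [e] (\<lambda>x. r *\<^sub>R u x + s *\<^sub>R v x) (\<lambda>x. (r *\<^sub>R G x + s *\<^sub>R G' x) \<bullet> e)"
    by (simp add: inner_add_left)
qed

lemma fn_seminorm_H1: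
  fixes \<Omega> :: "'a::euclidean_space set"
  assumes \<Omega>: "open \<Omega>"
  shows "fn_seminorm (H1 \<Omega>) (H1_norm \<Omega>)"
proof
  fix u v :: "'a \<Rightarrow> real" and r s :: real
  assume u: "u \<in> H1 \<Omega>" and v: "v \<in> H1 \<Omega>"
  let ?w = "\<lambda>x. r *\<^sub>R u x + s *\<^sub>R v x"
  show "?w \<in> H1 \<Omega>"
    using u v weak_gradient_lincomb[OF \<Omega>] L2_space_lincomb[of u \<Omega> v r s] unfolding H1_def by blast
  \<comment> \<open>Q is the L^2 norm of the pair (u, G) in the product space, so one use of
    Minkowski's inequality treats values and gradients together.\<close>
  define Q where "Q u G = sqrt ((LINT x|lebesgue_on \<Omega>. (u x)\<^sup>2) + (LINT x|lebesgue_on \<Omega>. (norm (G x))\<^sup>2))"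
    for u :: "'a \<Rightarrow> real" and G :: "'a \<Rightarrow> 'a"
  have Q: "Q u G = sqrt (LINT x|lebesgue_on \<Omega>. (norm (u x, G x))\<^sup>2)"
    "integrable (lebesgue_on \<Omega>) (\<lambda>x. (norm (u x, G x))\<^sup>2)"
    if "u \<in> L2_space \<Omega>" "G \<in> L2_space \<Omega>" for u G
    using that by (auto simp: Q_def L2_space_def norm_Pair)
  have H1Q: "H1_norm \<Omega> u = Inf (Q u ` {G. weak_gradient \<Omega> u G})" for u
    by (simp add: H1_norm_def Q_def)
  show "H1_norm \<Omega> ?w \<le> \<bar>r\<bar> * H1_norm \<Omega> u + \<bar>s\<bar> * H1_norm \<Omega> v"
    unfolding H1Q
  proof (rule Inf_lincomb_le)
    show "Q u ` {G. weak_gradient \<Omega> u G} \<noteq> {}" "Q v ` {G. weak_gradient \<Omega> v G} \<noteq> {}"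
      using u v by (auto simp: H1_def)
    show "bdd_below (Q ?w ` {G. weak_gradient \<Omega> ?w G})"
      by (rule bdd_belowI[of _ 0]) (auto simp: Q_def)
    fix a b assume "a \<in> Q u ` {G. weak_gradient \<Omega> u G}" "b \<in> Q v ` {G. weak_gradient \<Omega> v G}"
    then obtain G G' where G: "weak_gradient \<Omega> u G" "a = Q u G" and G': "weak_gradient \<Omega> v G'" "b = Q v G'"
      by blast
    let ?G = "\<lambda>x. r *\<^sub>R G x + s *\<^sub>R G' x"
    have w: "weak_gradient \<Omega> ?w ?G" by (rule weak_gradient_lincomb[OF \<Omega> G(1) G'(1)])
    have L2: "u \<in> L2_space \<Omega>" "v \<in> L2_space \<Omega>" "G \<in> L2_space \<Omega>" "G' \<in> L2_space \<Omega>"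
      using u v G G' by (auto simp: H1_def weak_gradient_def)
    then have [measurable]: "u \<in> borel_measurable (lebesgue_on \<Omega>)" "v \<in> borel_measurable (lebesgue_on \<Omega>)"
       "G \<in> borel_measurable (lebesgue_on \<Omega>)" "G' \<in> borel_measurable (lebesgue_on \<Omega>)"
      by (auto simp: L2_space_def)
    have "Q ?w ?G = sqrt (LINT x|lebesgue_on \<Omega>. (norm (r *\<^sub>R (u x, G x) + s *\<^sub>R (v x, G' x)))\<^sup>2)"
      using Q(1)[OF L2_space_lincomb[OF L2(1,2)] L2_space_lincomb[OF L2(3,4)], of r s r s] by simp
    also have "\<dots> \<le> \<bar>r\<bar> * Q u G + \<bar>s\<bar> * Q v G'"
      unfolding Q(1)[OF L2(1,3)] Q(1)[OF L2(2,4)]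
      by (rule L2_lincomb_square_integrable(2)) (use Q(2)[OF L2(1,3)] Q(2)[OF L2(2,4)] in \<open>measurable; simp\<close>)+
    finally show "\<exists>c\<in>Q ?w ` {G. weak_gradient \<Omega> ?w G}. c \<le> \<bar>r\<bar> * a + \<bar>s\<bar> * b"
      using w G G' by blast
  qed auto
qed

section \<open>Bounded coefficients and linearity of weak solutions\<close>

lemma continuous_on_closure_Linf:
  fixes f :: "'a::euclidean_space \<Rightarrow> 'b::euclidean_space"
  assumes "open \<Omega>" "bounded \<Omega>" "continuous_on (closure \<Omega>) f"
  shows "f \<in> Linf_space \<Omega>"
proof -
  have "continuous_on \<Omega> f" using assms(3) closure_subset by (rule continuous_on_subset)
  then have "f \<in> borel_measurable (lebesgue_on \<Omega>)"
    using assms by (intro continuous_imp_measurable_on_sets_lebesgue) auto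
  moreover have "bounded (f ` closure \<Omega>)"
    using assms by (intro compact_imp_bounded compact_continuous_image) auto
  then obtain M where "\<forall>x\<in>closure \<Omega>. norm (f x) \<le> M" by (auto simp: bounded_iff)
  then have "AE x in lebesgue_on \<Omega>. norm (f x) \<le> M"
    using closure_subset by (intro AE_I2) auto
  ultimately show ?thesis by (auto simp: Linf_space_def)
qed

text \<open>Both regularity regimes provide bounded measurable coefficients, which is what makes the
  weak form integrable: Hoelder coefficients are continuous on a compact closure, and the Sobolev
  ones are bounded by definition.\<close>

lemma regular_coefficients_Linf:
  fixes \<Omega> :: "(real^'d) set"
  assumes "open \<Omega>" "bounded \<Omega>" "regular_coefficients l \<alpha> \<Omega> a b c q T"
  shows "a \<in> Linf_space \<Omega>" "b \<in> Linf_space \<Omega>" "c \<in> Linf_space \<Omega>" "q \<in> Linf_space \<Omega>"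
proof -
  have Linf: "f \<in> Linf_space \<Omega>" if "f \<in> holder_space k \<alpha> (closure \<Omega>)"
    for f :: "real^'d \<Rightarrow> 'z::euclidean_space" and k
    using continuous_on_closure_Linf[OF assms(1,2)] that unfolding holder_space_def by blast
  show "a \<in> Linf_space \<Omega>" "b \<in> Linf_space \<Omega>"
    using assms(3) Linf unfolding regular_coefficients_def by (metis (no_types, lifting))+
  show "c \<in> Linf_space \<Omega>" "q \<in> Linf_space \<Omega>"
    using assms(3) unfolding regular_coefficients_def W_inf_def by (metis (no_types, lifting) mem_Collect_eq)+
qed

lemma norm_matrix_vector_mult_le:
  fixes A :: "real^'n^'m"
  shows "norm (A *v x) \<le> real CARD('m) * norm A * norm x"
proof -
  have "norm (A *v x) \<le> (\<Sum>i\<in>UNIV. \<bar>(A *v x) $ i\<bar>)" by (rule norm_le_l1_cart)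
  also have "\<dots> \<le> (\<Sum>i\<in>(UNIV :: 'm set). norm A * norm x)"
  proof (intro sum_mono)
    fix i
    have "\<bar>(A *v x) $ i\<bar> \<le> norm (A $ i) * norm x"
      unfolding matrix_vector_mul_component by (rule Cauchy_Schwarz_ineq2)
    also have "\<dots> \<le> norm A * norm x" by (intro mult_right_mono Finite_Cartesian_Product.norm_nth_le) auto
    finally show "\<bar>(A *v x) $ i\<bar> \<le> norm A * norm x" .
  qed
  finally show ?thesis by simp
qed

lemma borel_measurable_matrix_vector_mult:
  fixes A :: "'a \<Rightarrow> real^'n^'m"
  assumes "A \<in> borel_measurable M" "f \<in> borel_measurable M"
  shows "(\<lambda>x. A x *v f x) \<in> borel_measurable M"
proof -
  have "continuous_on UNIV (\<lambda>p :: (real^'n^'m) \<times> (real^'n). fst p *v snd p)"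
    unfolding matrix_vector_mult_def by (intro continuous_intros)
  then show ?thesis by (rule borel_measurable_continuous_Pair[OF assms])
qed

text \<open>Integrability is what allows the weak form to be split linearly. The integrand is
  dominated by a multiple of |G| + |u|, and on a bounded set square-integrable functions are
  integrable.\<close>

lemma integrable_weak_form:
  fixes \<Omega> :: "(real^'d) set"
  assumes \<Omega>: "open \<Omega>" "bounded \<Omega>"
    and coeffs: "a \<in> Linf_space \<Omega>" "b \<in> Linf_space \<Omega>" "c \<in> Linf_space \<Omega>" "q \<in> Linf_space \<Omega>"
    and u: "u \<in> L2_space \<Omega>" and G: "G \<in> L2_space \<Omega>" and \<phi>: "\<phi> \<in> test_functions \<Omega>"
  shows "integrable (lebesgue_on \<Omega>) (\<lambda>x. (a x *v G x + u x *\<^sub>R b x) \<bullet> gradient \<phi> x + (c x \<bullet> G x) * \<phi> x + q x * u x * \<phi> x)"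
proof -
  let ?M = "lebesgue_on \<Omega>"
  obtain C where C: "compact C" "C \<subseteq> \<Omega>"
    "\<And>es. set es \<subseteq> Basis \<Longrightarrow> continuous_on UNIV (iter_pderiv es \<phi>)"
    "\<And>es x. x \<notin> C \<Longrightarrow> iter_pderiv es \<phi> x = 0" using test_function_pderiv[OF \<phi>] by blast
  have cont\<phi>: "continuous_on UNIV \<phi>" and supp\<phi>: "\<And>x. x \<notin> C \<Longrightarrow> \<phi> x = 0"
    using C(3)[of "[]"] C(4)[of _ "[]"] by auto
  have contg: "continuous_on UNIV (gradient \<phi>)"
    unfolding gradient_def using C(3)
    by (intro continuous_on_sum continuous_on_scaleR continuous_on_const) (simp del: iter_pderiv.simps)
  have suppg: "\<And>x. x \<notin> C \<Longrightarrow> gradient \<phi> x = 0"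
    unfolding gradient_def using C(4) by (intro sum.neutral) (auto simp del: iter_pderiv.simps)
  obtain B where B: "0 \<le> B" "\<And>x. norm (\<phi> x) \<le> B"
    using compactly_supported_bounded[OF C(1) cont\<phi> supp\<phi>] by blast
  obtain B' where B': "0 \<le> B'" "\<And>x. norm (gradient \<phi> x) \<le> B'"
    using compactly_supported_bounded[OF C(1) contg suppg] by blast
  have meas: "f \<in> borel_measurable ?M" if "continuous_on UNIV f" for f :: "real^'d \<Rightarrow> 'z::euclidean_space"
    using that \<Omega> by (intro continuous_imp_measurable_on_sets_lebesgue) (auto intro: continuous_on_subset)
  have [measurable]: "\<phi> \<in> borel_measurable ?M" "gradient \<phi> \<in> borel_measurable ?M"
    by (intro meas cont\<phi> contg)+
  have [measurable]: "a \<in> borel_measurable ?M" "b \<in> borel_measurable ?M" "c \<in> borel_measurable ?M" "q \<in> borel_measurable ?M"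
    "u \<in> borel_measurable ?M" "G \<in> borel_measurable ?M"
    using coeffs u G by (auto simp: Linf_space_def L2_space_def)
  have [measurable]: "(\<lambda>x. a x *v G x) \<in> borel_measurable ?M"
    by (intro borel_measurable_matrix_vector_mult) auto
  obtain Ma Mb Mc Mq where AE: "AE x in ?M. norm (a x) \<le> Ma" "AE x in ?M. norm (b x) \<le> Mb"
      "AE x in ?M. norm (c x) \<le> Mc" "AE x in ?M. norm (q x) \<le> Mq"
    using coeffs by (auto simp: Linf_space_def)
  define k where "k = real CARD('d)"
  \<comment> \<open>B' and B bound gradient \<phi> and \<phi>. The coefficient of |G| collects the
    terms of a and c, that of |u| those of b and q.\<close>
  let ?g = "\<lambda>x. (k * Ma * B' + Mc * B) *\<^sub>R norm (G x) + (Mb * B' + Mq * B) *\<^sub>R norm (u x)"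
  have "integrable ?M ?g"
    using L2_integrable[OF \<Omega>(2,1) u] L2_integrable[OF \<Omega>(2,1) G]
    by (intro Bochner_Integration.integrable_add integrable_scaleR_right integrable_norm)
  then show ?thesis
  proof (rule Bochner_Integration.integrable_bound)
    show "AE x in ?M. norm ((a x *v G x + u x *\<^sub>R b x) \<bullet> gradient \<phi> x + (c x \<bullet> G x) * \<phi> x + q x * u x * \<phi> x) \<le> norm (?g x)"
      using AE
    proof eventually_elim
      fix x assume x: "norm (a x) \<le> Ma" "norm (b x) \<le> Mb" "norm (c x) \<le> Mc" "norm (q x) \<le> Mq"
      have "\<bar>(a x *v G x + u x *\<^sub>R b x) \<bullet> gradient \<phi> x\<bar> \<le> norm (a x *v G x + u x *\<^sub>R b x) * norm (gradient \<phi> x)"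
        by (rule Cauchy_Schwarz_ineq2)
      also have "\<dots> \<le> (k * Ma * norm (G x) + Mb * norm (u x)) * B'"
      proof (intro mult_mono B')
        have "norm (a x *v G x) \<le> k * norm (a x) * norm (G x)"
          unfolding k_def by (rule norm_matrix_vector_mult_le)
        also have "\<dots> \<le> k * Ma * norm (G x)"
          using x by (intro mult_right_mono mult_left_mono) (auto simp: k_def)
        finally have 1: "norm (a x *v G x) \<le> k * Ma * norm (G x)" .
        have 2: "norm (u x *\<^sub>R b x) \<le> Mb * norm (u x)"
          using mult_right_mono[OF x(2), of "norm (u x)"] by (simp add: mult.commute)
        show "norm (a x *v G x + u x *\<^sub>R b x) \<le> k * Ma * norm (G x) + Mb * norm (u x)"
          using norm_triangle_ineq[of "a x *v G x" "u x *\<^sub>R b x"] 1 2 by linarith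
        show "0 \<le> k * Ma * norm (G x) + Mb * norm (u x)"
          using order_trans[OF norm_ge_zero 1] order_trans[OF norm_ge_zero 2] by simp
      qed auto
      finally have 1: "\<bar>(a x *v G x + u x *\<^sub>R b x) \<bullet> gradient \<phi> x\<bar> \<le> (k * Ma * norm (G x) + Mb * norm (u x)) * B'" .
      have "\<bar>c x \<bullet> G x\<bar> \<le> norm (c x) * norm (G x)" by (rule Cauchy_Schwarz_ineq2)
      also have "\<dots> \<le> Mc * norm (G x)" using x by (intro mult_right_mono) auto
      finally have 2: "\<bar>(c x \<bullet> G x) * \<phi> x\<bar> \<le> (Mc * norm (G x)) * B"
        unfolding abs_mult using B(2)[of x] by (intro mult_mono) auto
      have "\<bar>q x * u x\<bar> \<le> Mq * norm (u x)"
        using x by (simp add: abs_mult mult_right_mono)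
      then have 3: "\<bar>q x * u x * \<phi> x\<bar> \<le> (Mq * norm (u x)) * B"
        unfolding abs_mult[of "q x * u x"] using B(2)[of x] by (intro mult_mono) auto
      have "norm ((a x *v G x + u x *\<^sub>R b x) \<bullet> gradient \<phi> x + (c x \<bullet> G x) * \<phi> x + q x * u x * \<phi> x)
          \<le> (k * Ma * norm (G x) + Mb * norm (u x)) * B' + (Mc * norm (G x)) * B + (Mq * norm (u x)) * B"
        using 1 2 3 by (simp add: abs_le_iff)
      also have "\<dots> = ?g x" by (simp add: algebra_simps)
      also have "\<dots> \<le> norm (?g x)" by simp
      finally show "norm ((a x *v G x + u x *\<^sub>R b x) \<bullet> gradient \<phi> x + (c x \<bullet> G x) * \<phi> x + q x * u x * \<phi> x) \<le> norm (?g x)" .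
    qed
  qed measurable
qed

text \<open>A weak solution comes with some weak gradient as witness; the same combination of the
  two witnesses serves for the combined function, as the integrand is linear in (u, G)
  jointly.\<close>

lemma weak_solution_lincomb:
  fixes \<Omega> :: "(real^'d) set"
  assumes \<Omega>: "open \<Omega>" "bounded \<Omega>"
    and coeffs: "a \<in> Linf_space \<Omega>" "b \<in> Linf_space \<Omega>" "c \<in> Linf_space \<Omega>" "q \<in> Linf_space \<Omega>"
    and u: "weak_solution \<Omega> a b c q u" and v: "weak_solution \<Omega> a b c q v"
  shows "weak_solution \<Omega> a b c q (\<lambda>x. r *\<^sub>R u x + s *\<^sub>R v x)"
proof -
  define I where "I u G \<phi> x = (a x *v G x + u x *\<^sub>R b x) \<bullet> gradient \<phi> x + (c x \<bullet> G x) * \<phi> x + q x * u x * \<phi> x"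
    for u :: "real^'d \<Rightarrow> real" and G \<phi> x
  obtain G where G: "weak_gradient \<Omega> u G" "\<And>\<phi>. \<phi> \<in> test_functions \<Omega> \<Longrightarrow> (LINT x|lebesgue_on \<Omega>. I u G \<phi> x) = 0"
    using u unfolding weak_solution_def I_def by blast
  obtain G' where G': "weak_gradient \<Omega> v G'" "\<And>\<phi>. \<phi> \<in> test_functions \<Omega> \<Longrightarrow> (LINT x|lebesgue_on \<Omega>. I v G' \<phi> x) = 0"
    using v unfolding weak_solution_def I_def by blast
  have H1: "u \<in> H1 \<Omega>" "v \<in> H1 \<Omega>" using u v by (auto simp: weak_solution_def)
  have L2: "u \<in> L2_space \<Omega>" "v \<in> L2_space \<Omega>" "G \<in> L2_space \<Omega>" "G' \<in> L2_space \<Omega>"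
    using H1 G G' by (auto simp: H1_def weak_gradient_def)
  let ?w = "\<lambda>x. r *\<^sub>R u x + s *\<^sub>R v x" and ?G = "\<lambda>x. r *\<^sub>R G x + s *\<^sub>R G' x"
  have "(LINT x|lebesgue_on \<Omega>. I ?w ?G \<phi> x) = 0" if \<phi>: "\<phi> \<in> test_functions \<Omega>" for \<phi>
  proof -
    have "I ?w ?G \<phi> x = r * I u G \<phi> x + s * I v G' \<phi> x" for x
      unfolding I_def
      by (simp only: matrix_vector_right_distrib matrix_vector_mult_scaleR inner_add_left inner_add_right
          inner_scaleR_left inner_scaleR_right real_scaleR_def) (simp only: ring_distribs mult_ac add_ac)
    moreover have "integrable (lebesgue_on \<Omega>) (I u G \<phi>)" "integrable (lebesgue_on \<Omega>) (I v G' \<phi>)"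
      unfolding I_def by (intro integrable_weak_form \<Omega> coeffs L2 \<phi>)+
    ultimately show ?thesis using G(2)[OF \<phi>] G'(2)[OF \<phi>] by simp
  qed
  moreover have "?w \<in> H1 \<Omega>" using fn_seminorm.lincomb_mem[OF fn_seminorm_H1[OF \<Omega>(1)] H1] .
  ultimately show ?thesis
    using weak_gradient_lincomb[OF \<Omega>(1) G(1) G'(1)] unfolding weak_solution_def I_def by blast
qed

lemma fn_seminorm_HK:
  fixes \<Omega> :: "(real^'d) set"
  assumes \<Omega>: "open \<Omega>" "bounded \<Omega>" and coeffs: "regular_coefficients l \<alpha> \<Omega> a b c q T" and K: "compact K"
  shows "fn_seminorm (HK l \<alpha> \<Omega> a b c q K) (HK_norm l \<alpha> \<Omega> K)"
proof
  fix u v :: "real^'d \<Rightarrow> real" and r s :: real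
  assume u: "u \<in> HK l \<alpha> \<Omega> a b c q K" and v: "v \<in> HK l \<alpha> \<Omega> a b c q K"
  let ?w = "\<lambda>x. r *\<^sub>R u x + s *\<^sub>R v x"
  interpret h: fn_seminorm "holder_space l \<alpha> K :: (real^'d \<Rightarrow> real) set" "holder_norm l \<alpha> K"
    by (rule fn_seminorm_holder[OF K])
  interpret H: fn_seminorm "H1 \<Omega>" "H1_norm \<Omega>" by (rule fn_seminorm_H1[OF \<Omega>(1)])
  show "?w \<in> HK l \<alpha> \<Omega> a b c q K"
    using u v h.lincomb_mem[of u v r s] H.lincomb_mem[of u v r s]
      weak_solution_lincomb[OF \<Omega> regular_coefficients_Linf[OF \<Omega> coeffs], of u v r s]
    by (simp add: HK_def)
  show "HK_norm l \<alpha> \<Omega> K ?w \<le> \<bar>r\<bar> * HK_norm l \<alpha> \<Omega> K u + \<bar>s\<bar> * HK_norm l \<alpha> \<Omega> K v"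
    using u v h.lincomb_le[of u v r s] H.lincomb_le[of u v r s]
    by (simp add: HK_def HK_norm_def algebra_simps)
qed

section \<open>Rank conditions on compact sets\<close>

lemma det_rows_ne_0_iff:
  fixes w :: "'n \<Rightarrow> real^'n"
  shows "det (\<chi> j. w j) \<noteq> 0 \<longleftrightarrow> (\<forall>\<xi>. \<xi> \<noteq> 0 \<longrightarrow> (\<exists>j. w j \<bullet> \<xi> \<noteq> 0))"
proof -
  have "det (\<chi> j. w j) \<noteq> 0 \<longleftrightarrow> (\<forall>\<xi>. (\<chi> j. w j) *v \<xi> = 0 \<longrightarrow> \<xi> = 0)"
    unfolding invertible_det_nz[symmetric] invertible_left_inverse matrix_left_invertible_ker ..
  also have "\<dots> \<longleftrightarrow> (\<forall>\<xi>. \<xi> \<noteq> 0 \<longrightarrow> (\<exists>j. w j \<bullet> \<xi> \<noteq> 0))"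
    by (auto simp: vec_eq_iff matrix_vector_mul_component)
  finally show ?thesis .
qed

text \<open>Both sides say that the N rows have rank n. Determinants are thereby traded for pairings
  with \<xi>, which vary continuously with the row and with \<xi> and can be estimated row by
  row.\<close>

lemma sum_abs_minors_pos_iff:
  fixes A :: "nat \<Rightarrow> real^'n"
  shows "0 < (\<Sum>i\<in>(UNIV :: 'n set) \<rightarrow>\<^sub>E {..<N}. \<bar>det (\<chi> j. A (i j))\<bar>) \<longleftrightarrow>
    (\<forall>\<xi>. \<xi> \<noteq> 0 \<longrightarrow> (\<exists>i<N. A i \<bullet> \<xi> \<noteq> 0))" (is "?L \<longleftrightarrow> ?R")
proof -
  have fin: "finite ((UNIV :: 'n set) \<rightarrow>\<^sub>E {..<N})" by (intro finite_PiE) auto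
  have "?L \<longleftrightarrow> (\<exists>i\<in>(UNIV :: 'n set) \<rightarrow>\<^sub>E {..<N}. det (\<chi> j. A (i j)) \<noteq> 0)"
    using sum_nonneg_eq_0_iff[OF fin, of "\<lambda>i. \<bar>det (\<chi> j. A (i j))\<bar>"]
      sum_nonneg[of "(UNIV :: 'n set) \<rightarrow>\<^sub>E {..<N}" "\<lambda>i. \<bar>det (\<chi> j. A (i j))\<bar>"]
    by (auto simp: less_le)
  also have "\<dots> \<longleftrightarrow> ?R"
  proof
    assume "\<exists>i\<in>(UNIV :: 'n set) \<rightarrow>\<^sub>E {..<N}. det (\<chi> j. A (i j)) \<noteq> 0"
    then obtain i where i: "i \<in> UNIV \<rightarrow>\<^sub>E {..<N}" "det (\<chi> j. A (i j)) \<noteq> 0" by blast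
    show ?R
    proof (intro allI impI)
      fix \<xi> :: "real^'n" assume "\<xi> \<noteq> 0"
      then obtain j where "A (i j) \<bullet> \<xi> \<noteq> 0" using i(2) unfolding det_rows_ne_0_iff by blast
      moreover have "i j < N" using i(1) by (auto simp: PiE_iff)
      ultimately show "\<exists>i<N. A i \<bullet> \<xi> \<noteq> 0" by blast
    qed
  next
    assume R: ?R
    define S where "S = A ` {..<N}"
    have spanS: "span S = UNIV"
    proof (rule ccontr)
      assume "span S \<noteq> UNIV"
      then obtain \<xi> where \<xi>: "\<xi> \<noteq> 0" "\<forall>x\<in>span S. \<xi> \<bullet> x = 0"
        using span_not_UNIV_orthogonal by blast
      obtain i where "i < N" "A i \<bullet> \<xi> \<noteq> 0" using R \<xi>(1) by blast
      moreover have "A i \<in> span S" using \<open>i < N\<close> by (auto simp: S_def intro: span_base)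
      ultimately show False using \<xi>(2) by (auto simp: inner_commute)
    qed
    obtain B where B: "B \<subseteq> S" "independent B" "S \<subseteq> span B" "card B = dim S"
      using basis_exists[of S] by blast
    have spanB: "span B = UNIV"
      using span_mono[OF B(3)] spanS by (auto simp: span_span)
    have "dim S = CARD('n)" using spanS by (metis dim_span dim_UNIV DIM_cart DIM_real mult.right_neutral)
    then have "card B = card (UNIV :: 'n set)" using B by simp
    moreover have "finite B" using B(1) by (rule finite_subset) (simp add: S_def)
    \<comment> \<open>Enumerating a basis contained in the set of rows by the index type 'n selects
      the n rows of a nonzero minor.\<close>
    ultimately obtain f where f: "bij_betw f (UNIV :: 'n set) B"
      using finite_same_card_bij[of "UNIV :: 'n set" B] by auto
    then have "f j \<in> A ` {..<N}" for j using bij_betwE[OF f] B(1) by (auto simp: S_def)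
    then have "\<forall>j. \<exists>k. k < N \<and> f j = A k" by blast
    then obtain i where i: "\<And>j. i j < N" "\<And>j. f j = A (i j)" using choice by metis
    have "det (\<chi> j. A (i j)) \<noteq> 0"
      unfolding det_rows_ne_0_iff
    proof (intro allI impI, rule ccontr)
      fix \<xi> :: "real^'n" assume \<xi>: "\<xi> \<noteq> 0" "\<not> (\<exists>j. A (i j) \<bullet> \<xi> \<noteq> 0)"
      have "\<forall>b\<in>B. \<xi> \<bullet> b = 0"
      proof
        fix b assume "b \<in> B"
        then obtain j where "b = f j" using f by (auto simp: bij_betw_def)
        then show "\<xi> \<bullet> b = 0" using \<xi>(2) i(2) by (simp add: inner_commute)
      qed
      \<comment> \<open>The basis spans the whole space, so a vector orthogonal to it is orthogonal
        to itself.\<close>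
      then have "orthogonal \<xi> \<xi>"
        using orthogonal_to_span[of \<xi> B \<xi>] spanB by (auto simp: orthogonal_def)
      then show False using \<xi>(1) by (simp add: orthogonal_def)
    qed
    then show "\<exists>i\<in>(UNIV :: 'n set) \<rightarrow>\<^sub>E {..<N}. det (\<chi> j. A (i j)) \<noteq> 0"
      using i(1) by (intro bexI[of _ i]) auto
  qed
  finally show ?thesis .
qed

lemma admissible_set_eq:
  fixes \<zeta> :: "(real^'d \<Rightarrow> real) \<Rightarrow> real^'d \<Rightarrow> real^'n"
  shows "admissible_set N H \<zeta> K =
    {u \<in> {..<N} \<rightarrow>\<^sub>E H. \<forall>x\<in>K. \<forall>\<xi>. \<xi> \<noteq> 0 \<longrightarrow> (\<exists>i<N. \<zeta> (u i) x \<bullet> \<xi> \<noteq> 0)}"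
proof -
  have "0 < (\<Sum>i\<in>(UNIV :: 'n set) \<rightarrow>\<^sub>E {..<N}. \<bar>det (\<chi> j. \<zeta> (u (i j)) x)\<bar>) \<longleftrightarrow>
      (\<forall>\<xi>. \<xi> \<noteq> 0 \<longrightarrow> (\<exists>i<N. \<zeta> (u i) x \<bullet> \<xi> \<noteq> 0))" for u x
    by (rule sum_abs_minors_pos_iff[of "\<lambda>i. \<zeta> (u i) x"])
  then show ?thesis by (simp add: admissible_set_def)
qed

text \<open>The sum is continuous and positive on the compact product of K with the unit sphere, so
  it attains a positive minimum there; homogeneity in \<xi> does the rest. The resulting m is the
  stability margin for openness and the source of the constant c for density.\<close>

lemma sum_abs_inner_bounded_below:
  fixes f :: "'i \<Rightarrow> 'a::metric_space \<Rightarrow> 'b::euclidean_space"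
  assumes K: "compact K" and I: "finite I" and f: "\<And>i. i \<in> I \<Longrightarrow> continuous_on K (f i)"
    and nz: "\<And>x \<xi>. x \<in> K \<Longrightarrow> \<xi> \<noteq> 0 \<Longrightarrow> \<exists>i\<in>I. f i x \<bullet> \<xi> \<noteq> 0"
  obtains m where "0 < m" "\<And>x \<xi>. x \<in> K \<Longrightarrow> m * norm \<xi> \<le> (\<Sum>i\<in>I. \<bar>f i x \<bullet> \<xi>\<bar>)"
proof (cases "K = {}")
  case True
  then show thesis using that[of 1] by auto
next
  case False
  define g where "g p = (\<Sum>i\<in>I. \<bar>f i (fst p) \<bullet> snd p\<bar>)" for p
  define S where "S = K \<times> sphere (0 :: 'b) 1"
  have S: "compact S" "S \<noteq> {}" using K False by (auto simp: S_def intro: compact_Times)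
  have "continuous_on S (\<lambda>p. f i (fst p))" if "i \<in> I" for i
    by (rule continuous_on_compose2[OF f[OF that]]) (auto simp: S_def intro: continuous_intros)
  then have "continuous_on S g"
    unfolding g_def by (intro continuous_on_sum continuous_on_rabs continuous_on_inner continuous_on_snd continuous_on_id)
  then obtain p where p: "p \<in> S" "\<And>q. q \<in> S \<Longrightarrow> g p \<le> g q"
    using continuous_attains_inf[OF S] by blast
  obtain i where i: "i \<in> I" "f i (fst p) \<bullet> snd p \<noteq> 0"
    using p(1) nz[of "fst p" "snd p"] by (force simp: S_def)
  have "0 < g p"
    unfolding g_def using i I by (intro sum_pos2[of _ i]) auto
  moreover have "g p * norm \<xi> \<le> (\<Sum>i\<in>I. \<bar>f i x \<bullet> \<xi>\<bar>)" if x: "x \<in> K" for x \<xi>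
  proof (cases "\<xi> = 0")
    case True
    then show ?thesis by simp
  next
    case False
    have "g p \<le> g (x, \<xi> /\<^sub>R norm \<xi>)" using x False by (intro p(2)) (auto simp: S_def)
    also have "\<dots> = (\<Sum>i\<in>I. \<bar>f i x \<bullet> \<xi>\<bar>) / norm \<xi>"
      by (simp add: g_def abs_mult sum_distrib_left[symmetric] divide_inverse mult.commute)
    finally show ?thesis using False by (simp add: field_simps)
  qed
  ultimately show thesis by (rule that)
qed

text \<open>The sets of pairs (x, \<xi>) on which one f i has nonzero pairing form an open cover of
  the product of K with the unit sphere; a finite subcover gives F.\<close>

lemma finite_subfamily_nonvanishing:
  fixes f :: "'i \<Rightarrow> 'a::metric_space \<Rightarrow> 'b::euclidean_space"
  assumes K: "compact K" and f: "\<And>i. i \<in> I \<Longrightarrow> continuous_on K (f i)"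
    and nz: "\<And>x \<xi>. x \<in> K \<Longrightarrow> \<xi> \<noteq> 0 \<Longrightarrow> \<exists>i\<in>I. f i x \<bullet> \<xi> \<noteq> 0"
  obtains F where "F \<subseteq> I" "finite F" "\<And>x \<xi>. x \<in> K \<Longrightarrow> \<xi> \<noteq> 0 \<Longrightarrow> \<exists>i\<in>F. f i x \<bullet> \<xi> \<noteq> 0"
proof -
  define S where "S = K \<times> sphere (0 :: 'b) 1"
  define V where "V i = S \<inter> (\<lambda>p. f i (fst p) \<bullet> snd p) -` (- {0})" for i
  have S: "compact S" using K by (auto simp: S_def intro: compact_Times)
  have "openin (top_of_set S) (V i)" if "i \<in> I" for i
  proof -
    have "continuous_on S (\<lambda>p. f i (fst p))"
      by (rule continuous_on_compose2[OF f[OF that]]) (auto simp: S_def intro: continuous_intros)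
    then have "continuous_on S (\<lambda>p. f i (fst p) \<bullet> snd p)"
      by (intro continuous_on_inner continuous_on_snd continuous_on_id)
    then show ?thesis unfolding V_def by (rule continuous_openin_preimage_gen) auto
  qed
  moreover have "S \<subseteq> \<Union> (V ` I)"
  proof
    fix p assume p: "p \<in> S"
    then obtain i where "i \<in> I" "f i (fst p) \<bullet> snd p \<noteq> 0"
      using nz[of "fst p" "snd p"] by (force simp: S_def)
    then show "p \<in> \<Union> (V ` I)" using p by (auto simp: V_def)
  qed
  ultimately obtain D where D: "D \<subseteq> V ` I" "finite D" "S \<subseteq> \<Union> D"
    using S unfolding compact_eq_openin_cover by (metis (no_types, lifting) image_iff)
  then obtain F where F: "F \<subseteq> I" "finite F" "D = V ` F" by (meson finite_subset_image)
  show thesis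
  proof (rule that[OF F(1,2)])
    fix x and \<xi> :: 'b assume x: "x \<in> K" and \<xi>: "\<xi> \<noteq> 0"
    then have "(x, \<xi> /\<^sub>R norm \<xi>) \<in> S" by (auto simp: S_def)
    then obtain i where "i \<in> F" "(x, \<xi> /\<^sub>R norm \<xi>) \<in> V i" using D(3) F(3) by blast
    then show "\<exists>i\<in>F. f i x \<bullet> \<xi> \<noteq> 0" by (intro bexI[of _ i]) (auto simp: V_def)
  qed
qed

section \<open>Pointwise use of \<zeta>, and perturbation of tuples of solutions\<close>

lemma continuous_linear_holder_mem:
  assumes "continuous_linear_holder l \<alpha> K \<zeta>" "u \<in> holder_space l \<alpha> K"
  shows "\<zeta> u \<in> holder_space 0 \<alpha> K"
proof -
  have "continuous_map (holder_topology l \<alpha> K) (holder_topology 0 \<alpha> K) \<zeta>"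
    using assms(1) by (simp add: continuous_linear_holder_def)
  then show ?thesis
    using assms(2) by (auto simp: continuous_map_def holder_topology_def)
qed

text \<open>Linearity of \<zeta> is given only for values at points of K and arguments in the
  Hoelder space, so each partial sum must be shown to lie in that space.\<close>

lemma continuous_linear_holder_sum:
  assumes \<zeta>: "continuous_linear_holder l \<alpha> K \<zeta>" and K: "compact K"
    and u: "u \<in> holder_space l \<alpha> K" and F: "finite F" "F \<subseteq> holder_space l \<alpha> K" and x: "x \<in> K"
  shows "\<zeta> (\<lambda>y. u y + (\<Sum>f\<in>F. t f *\<^sub>R f y)) x = \<zeta> u x + (\<Sum>f\<in>F. t f *\<^sub>R \<zeta> f x)"
  using F
proof (induction F)
  case empty
  then show ?case by simp
next
  case (insert f F)
  interpret fn_seminorm "holder_space l \<alpha> K :: (real^'a \<Rightarrow> real) set" "holder_norm l \<alpha> K"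
    by (rule fn_seminorm_holder[OF K])
  have add: "\<zeta> (\<lambda>y. v y + w y) x = \<zeta> v x + \<zeta> w x" if "v \<in> holder_space l \<alpha> K" "w \<in> holder_space l \<alpha> K" for v w
    using \<zeta> that x unfolding continuous_linear_holder_def by blast
  have scale: "\<zeta> (\<lambda>y. r * v y) x = r *\<^sub>R \<zeta> v x" if "v \<in> holder_space l \<alpha> K" for r v
    using \<zeta> that x unfolding continuous_linear_holder_def by blast
  have f: "f \<in> holder_space l \<alpha> K" and F: "F \<subseteq> holder_space l \<alpha> K" using insert.prems by auto
  have "(\<lambda>y. \<Sum>f\<in>F. t f *\<^sub>R f y) \<in> holder_space l \<alpha> K"
    using sum_mem_le[OF u insert.hyps(1) F] by blast
  then have 1: "(\<lambda>y. u y + (\<Sum>f\<in>F. t f *\<^sub>R f y)) \<in> holder_space l \<alpha> K"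
    using lincomb_mem[OF u, of _ 1 1] by simp
  have 2: "(\<lambda>y. t f * f y) \<in> holder_space l \<alpha> K"
    using lincomb_mem[OF f f, of "t f" 0] by simp
  have "(\<lambda>y. u y + (\<Sum>f\<in>insert f F. t f *\<^sub>R f y)) = (\<lambda>y. (u y + (\<Sum>f\<in>F. t f *\<^sub>R f y)) + t f * f y)"
    using insert.hyps by (simp add: add_ac)
  then show ?case
    using add[OF 1 2] scale[OF f, of "t f"] insert.IH[OF F] insert.hyps by (simp add: add_ac)
qed

text \<open>Topological continuity becomes an epsilon-delta statement at u: the preimage of a ball
  is open and so contains a ball. The order-0 Hoelder norm dominates values on K, which makes
  \<delta> independent of x.\<close>

lemma continuous_linear_holder_uniform:
  fixes K :: "(real^'d) set"
  assumes \<zeta>: "continuous_linear_holder l \<alpha> K \<zeta>" and K: "compact K" "K = closure (interior K)"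
    and u: "u \<in> holder_space l \<alpha> K" and e: "0 < e"
  obtains \<delta> where "0 < \<delta>" "\<And>v x. v \<in> holder_space l \<alpha> K \<Longrightarrow> holder_norm l \<alpha> K (\<lambda>y. v y - u y) < \<delta> \<Longrightarrow>
      x \<in> K \<Longrightarrow> norm (\<zeta> v x - \<zeta> u x) < e"
proof -
  interpret h: fn_seminorm "holder_space l \<alpha> K :: (real^'d \<Rightarrow> real) set" "holder_norm l \<alpha> K"
    by (rule fn_seminorm_holder[OF K(1)])
  interpret h0: fn_seminorm "holder_space 0 \<alpha> K :: (real^'d \<Rightarrow> real^'a) set" "holder_norm 0 \<alpha> K"
    by (rule fn_seminorm_holder[OF K(1)])
  note mem = continuous_linear_holder_mem[OF \<zeta>]
  define B where "B = {w \<in> holder_space 0 \<alpha> K. holder_norm 0 \<alpha> K (\<lambda>y. w y - \<zeta> u y) < e}"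
  have "openin (holder_topology 0 \<alpha> K) B"
    unfolding holder_topology_def B_def by (rule h0.openin_ball[OF mem[OF u] e])
  moreover have "continuous_map (holder_topology l \<alpha> K) (holder_topology 0 \<alpha> K) \<zeta>"
    using \<zeta> by (simp add: continuous_linear_holder_def)
  ultimately have "openin (norm_topology (holder_space l \<alpha> K) (holder_norm l \<alpha> K)) {v \<in> holder_space l \<alpha> K. \<zeta> v \<in> B}"
    using openin_continuous_map_preimage[of "holder_topology l \<alpha> K"] by (fastforce simp: holder_topology_def)
  moreover have "u \<in> {v \<in> holder_space l \<alpha> K. \<zeta> v \<in> B}"
    unfolding B_def using u h0.center_mem_ball[OF mem[OF u] e] by blast
  ultimately obtain \<delta> where \<delta>: "0 < \<delta>"
    "{v \<in> holder_space l \<alpha> K. holder_norm l \<alpha> K (\<lambda>y. v y - u y) < \<delta>} \<subseteq> {v \<in> holder_space l \<alpha> K. \<zeta> v \<in> B}"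
    using h.openin_contains_ball by blast
  show thesis
  proof (rule that[OF \<delta>(1)])
    fix v x assume v: "v \<in> holder_space l \<alpha> K" "holder_norm l \<alpha> K (\<lambda>y. v y - u y) < \<delta>" and x: "x \<in> K"
    have "\<zeta> v \<in> B" using \<delta>(2) v by blast
    moreover have "norm (\<zeta> v x - \<zeta> u x) \<le> holder_norm 0 \<alpha> K (\<lambda>y. \<zeta> v y - \<zeta> u y)"
      using norm_le_holder_norm_0[OF K h0.diff_mem[OF mem[OF v(1)] mem[OF u]] x] .
    ultimately show "norm (\<zeta> v x - \<zeta> u x) < e" by (simp add: B_def)
  qed
qed

text \<open>Hoelder norms are measured in the interior; this density is what transfers their
  estimates to all of K.\<close>

lemma smooth_compact_closure_interior:
  assumes "smooth_compact K"
  shows "K = closure (interior K)"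
proof
  obtain D where D: "open D" "K = closure D" using assms by (auto simp: smooth_compact_def)
  then have "D \<subseteq> interior K" using closure_subset interior_maximal by metis
  then show "K \<subseteq> closure (interior K)" using D closure_mono by metis
  show "closure (interior K) \<subseteq> K"
    using D by (metis closed_closure closure_minimal interior_subset)
qed

text \<open>The family F is fixed before the tuple u and the size \<epsilon>, so that \<epsilon> can
  later be chosen in terms of the norms of the members of F.\<close>

lemma admissible_set_perturbation:
  fixes K :: "(real^'d) set" and \<zeta> :: "(real^'d \<Rightarrow> real) \<Rightarrow> real^'d \<Rightarrow> real^'n"
  assumes K: "compact K" "K = closure (interior K)" and \<alpha>: "0 < \<alpha>" "\<alpha> \<le> 1"
    and \<zeta>: "continuous_linear_holder l \<alpha> K \<zeta>" and H: "H \<subseteq> holder_space l \<alpha> K"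
    and cand: "candidate_set H \<zeta> K = K"
    and N: "real CARD('d) / \<alpha> + real (CARD('n) - 1) < real N"
  obtains F where "F \<subseteq> H" "finite F"
    "\<And>u \<epsilon>. u \<in> {..<N} \<rightarrow> H \<Longrightarrow> 0 < \<epsilon> \<Longrightarrow> \<exists>t. (\<forall>i<N. \<forall>f\<in>F. \<bar>t i f\<bar> \<le> \<epsilon>) \<and>
      (\<forall>x\<in>K. \<forall>\<xi>. \<xi> \<noteq> 0 \<longrightarrow> (\<exists>i<N. \<zeta> (\<lambda>y. u i y + (\<Sum>f\<in>F. t i f *\<^sub>R f y)) x \<bullet> \<xi> \<noteq> 0))"
proof -
  have mem: "\<zeta> f \<in> holder_space 0 \<alpha> K" if "f \<in> H" for f
    using continuous_linear_holder_mem[OF \<zeta>] H that by blast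
  have cont: "continuous_on K (\<zeta> f)" if "f \<in> H" for f
    using mem[OF that] by (simp add: holder_space_def)
  have nz: "\<exists>f\<in>H. \<zeta> f x \<bullet> \<xi> \<noteq> 0" if "x \<in> K" "\<xi> \<noteq> 0" for x \<xi>
  proof -
    have "x \<in> candidate_set H \<zeta> K" using cand that(1) by simp
    then obtain u :: "'n \<Rightarrow> real^'d \<Rightarrow> real" where u: "\<And>j. u j \<in> H" "det (\<chi> j. \<zeta> (u j) x) \<noteq> 0"
      unfolding candidate_set_def by blast
    have "\<exists>j. \<zeta> (u j) x \<bullet> \<xi> \<noteq> 0"
      using u(2) det_rows_ne_0_iff[of "\<lambda>j. \<zeta> (u j) x"] that(2) by blast
    then show ?thesis using u(1) by blast
  qed
  obtain F where F: "F \<subseteq> H" "finite F" "\<And>x \<xi>. x \<in> K \<Longrightarrow> \<xi> \<noteq> 0 \<Longrightarrow> \<exists>f\<in>F. \<zeta> f x \<bullet> \<xi> \<noteq> 0"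
    using finite_subfamily_nonvanishing[OF K(1) cont nz] by blast
  have contF: "continuous_on K (\<zeta> f)" if "f \<in> F" for f using cont F(1) that by blast
  obtain m where m: "0 < m" "\<And>x \<xi>. x \<in> K \<Longrightarrow> m * norm \<xi> \<le> (\<Sum>f\<in>F. \<bar>\<zeta> f x \<bullet> \<xi>\<bar>)"
    using sum_abs_inner_bounded_below[OF K(1) F(2) contF F(3)] by blast
  \<comment> \<open>If all card F terms were below c, their sum would be below m, although \<xi> has
    norm at least 1. The added 1 makes this strict and allows empty F.\<close>
  define c where "c = m / (real (card F) + 1)"
  have c: "0 < c" using m(1) by (simp add: c_def)
  have low: "\<exists>f\<in>F. c \<le> \<bar>\<zeta> f x \<bullet> \<xi>\<bar>" if x: "x \<in> K" and \<xi>: "\<exists>j. \<xi> $ j = 1" for x \<xi>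
  proof (rule ccontr)
    assume "\<not> (\<exists>f\<in>F. c \<le> \<bar>\<zeta> f x \<bullet> \<xi>\<bar>)"
    then have "(\<Sum>f\<in>F. \<bar>\<zeta> f x \<bullet> \<xi>\<bar>) \<le> (\<Sum>f\<in>F. c)" by (intro sum_mono) (meson not_le less_imp_le)
    also have "\<dots> < m" using m(1) by (simp add: c_def field_simps)
    also have "m \<le> m * norm \<xi>"
    proof -
      obtain j where "\<xi> $ j = 1" using \<xi> by blast
      then have "1 \<le> norm \<xi>" using component_le_norm_cart[of \<xi> j] by simp
      then show ?thesis using m(1) by simp
    qed
    finally show False using m(2)[OF x, of \<xi>] by linarith
  qed
  show thesis
  proof (rule that[OF F(1,2)])
    fix u :: "nat \<Rightarrow> real^'d \<Rightarrow> real" and \<epsilon> :: real assume u: "u \<in> {..<N} \<rightarrow> H" and \<epsilon>: "0 < \<epsilon>"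
    \<comment> \<open>A is a finite family containing the given rows and the perturbing functions;
      sums over A provide one Hoelder constant and one bound for all of them.\<close>
    define A where "A = u ` {..<N} \<union> F"
    have A: "finite A" "A \<subseteq> H" using u F by (auto simp: A_def)
    have "\<forall>f\<in>A. \<exists>M. holder_bound \<alpha> K (\<zeta> f) M"
      using A mem holder_space_0_bound[OF K(2) \<alpha>(1)] by blast
    then obtain M where M: "\<And>f. f \<in> A \<Longrightarrow> holder_bound \<alpha> K (\<zeta> f) (M f)" by metis
    have "\<forall>f\<in>A. \<exists>b\<ge>0. \<forall>x\<in>K. norm (\<zeta> f x) \<le> b"
    proof
      fix f assume "f \<in> A"
      then have "bounded (\<zeta> f ` K)" using A cont K by (intro compact_imp_bounded compact_continuous_image) auto
      then obtain b where "\<forall>x\<in>K. norm (\<zeta> f x) \<le> b" by (auto simp: bounded_iff)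
      then show "\<exists>b\<ge>0. \<forall>x\<in>K. norm (\<zeta> f x) \<le> b" by (intro exI[of _ "max b 0"]) auto
    qed
    then obtain b where b: "\<And>f. f \<in> A \<Longrightarrow> 0 \<le> b f" "\<And>f x. f \<in> A \<Longrightarrow> x \<in> K \<Longrightarrow> norm (\<zeta> f x) \<le> b f" by metis
    have M0: "0 \<le> M f" if "f \<in> A" for f using M[OF that] by (simp add: holder_bound_def)
    have Hol: "norm (\<zeta> f x - \<zeta> f x') \<le> sum M A * dist x x' powr \<alpha>" if "f \<in> A" "x \<in> K" "x' \<in> K" for f x x'
    proof -
      have "norm (\<zeta> f x - \<zeta> f x') \<le> M f * dist x x' powr \<alpha>"
        using M[OF that(1)] that by (simp add: holder_bound_def)
      also have "\<dots> \<le> sum M A * dist x x' powr \<alpha>"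
        using member_le_sum[of f A M] M0 A that by (intro mult_right_mono) auto
      finally show ?thesis .
    qed
    have Bd: "norm (\<zeta> f x) \<le> sum b A" if "f \<in> A" "x \<in> K" for f x
      using b(2)[OF that] member_le_sum[of f A b] b(1) A that by force
    have uA: "u i \<in> A" if "i < N" for i using that by (auto simp: A_def)
    have FA: "f \<in> A" if "f \<in> F" for f using that by (auto simp: A_def)
    obtain t where t: "\<And>i f. i < N \<Longrightarrow> f \<in> F \<Longrightarrow> \<bar>t i f\<bar> \<le> \<epsilon>"
      "\<And>x \<xi>. x \<in> K \<Longrightarrow> \<xi> \<noteq> 0 \<Longrightarrow> \<exists>i<N. (\<zeta> (u i) x + (\<Sum>f\<in>F. t i f *\<^sub>R \<zeta> f x)) \<bullet> \<xi> \<noteq> 0"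
    proof (rule exists_nonvanishing_combination[of K \<alpha> N F "\<lambda>i. \<zeta> (u i)" "sum M A" \<zeta> "sum b A" c \<epsilon>])
      show "bounded K" using K(1) by (rule compact_imp_bounded)
      show "norm (\<zeta> (u i) x - \<zeta> (u i) x') \<le> sum M A * dist x x' powr \<alpha>" if "i < N" "x \<in> K" "x' \<in> K" for i x x'
        by (rule Hol[OF uA[OF that(1)] that(2,3)])
      show "norm (\<zeta> f x - \<zeta> f x') \<le> sum M A * dist x x' powr \<alpha>" if "f \<in> F" "x \<in> K" "x' \<in> K" for f x x'
        by (rule Hol[OF FA[OF that(1)] that(2,3)])
      show "norm (\<zeta> (u i) x) \<le> sum b A" if "i < N" "x \<in> K" for i x
        by (rule Bd[OF uA[OF that(1)] that(2)])
      show "norm (\<zeta> f x) \<le> sum b A" if "f \<in> F" "x \<in> K" for f x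
        by (rule Bd[OF FA[OF that(1)] that(2)])
      show "0 \<le> sum M A" "0 \<le> sum b A" using M0 b(1) by (auto intro: sum_nonneg)
      show "\<exists>f\<in>F. c \<le> \<bar>\<zeta> f x \<bullet> \<xi>\<bar>" if "x \<in> K" "\<exists>j. \<xi> $ j = 1" for x \<xi>
        by (rule low[OF that])
    qed (use \<alpha> N F(2) c \<epsilon> in blast)+
    have eq: "\<zeta> (\<lambda>y. u i y + (\<Sum>f\<in>F. t i f *\<^sub>R f y)) x = \<zeta> (u i) x + (\<Sum>f\<in>F. t i f *\<^sub>R \<zeta> f x)"
      if "i < N" "x \<in> K" for i x
      using continuous_linear_holder_sum[OF \<zeta> K(1) _ F(2) _ that(2)] uA[OF that(1)] A(2) F(1) H by blast
    have "\<exists>i<N. \<zeta> (\<lambda>y. u i y + (\<Sum>f\<in>F. t i f *\<^sub>R f y)) x \<bullet> \<xi> \<noteq> 0"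
      if "x \<in> K" "\<xi> \<noteq> 0" for x \<xi>
    proof -
      obtain i where i: "i < N" "(\<zeta> (u i) x + (\<Sum>f\<in>F. t i f *\<^sub>R \<zeta> f x)) \<bullet> \<xi> \<noteq> 0"
        using t(2)[OF \<open>x \<in> K\<close> \<open>\<xi> \<noteq> 0\<close>] by blast
      have "\<zeta> (\<lambda>y. u i y + (\<Sum>f\<in>F. t i f *\<^sub>R f y)) x \<bullet> \<xi> \<noteq> 0"
        unfolding eq[OF i(1) \<open>x \<in> K\<close>] by (rule i(2))
      then show ?thesis using i(1) by blast
    qed
    then show "\<exists>t. (\<forall>i<N. \<forall>f\<in>F. \<bar>t i f\<bar> \<le> \<epsilon>) \<and>
      (\<forall>x\<in>K. \<forall>\<xi>. \<xi> \<noteq> 0 \<longrightarrow> (\<exists>i<N. \<zeta> (\<lambda>y. u i y + (\<Sum>f\<in>F. t i f *\<^sub>R f y)) x \<bullet> \<xi> \<noteq> 0))"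
      using t(1) by blast
  qed
qed

text \<open>If all rows of a nearby tuple annihilated some \<xi> \<noteq> 0 at x, each original row
  would pair with \<xi> to at most e * norm \<xi>, contradicting the uniform lower bound m on the
  sum.\<close>

lemma admissible_set_stable:
  fixes K :: "(real^'d) set" and \<zeta> :: "(real^'d \<Rightarrow> real) \<Rightarrow> real^'d \<Rightarrow> real^'n"
  assumes K: "compact K" "K = closure (interior K)"
    and \<zeta>: "continuous_linear_holder l \<alpha> K \<zeta>" and H: "H \<subseteq> holder_space l \<alpha> K"
    and u: "u \<in> admissible_set N H \<zeta> K"
  obtains \<delta> where "\<And>i. i < N \<Longrightarrow> 0 < \<delta> i"
    "\<And>v. v \<in> {..<N} \<rightarrow>\<^sub>E H \<Longrightarrow> (\<And>i. i < N \<Longrightarrow> holder_norm l \<alpha> K (\<lambda>y. v i y - u i y) < \<delta> i) \<Longrightarrow>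
      v \<in> admissible_set N H \<zeta> K"
proof -
  have uH: "u i \<in> holder_space l \<alpha> K" if "i < N" for i
    using u H that unfolding admissible_set_eq by (auto simp: PiE_iff)
  have "continuous_on K (\<zeta> (u i))" if "i < N" for i
    using continuous_linear_holder_mem[OF \<zeta> uH[OF that]] by (simp add: holder_space_def)
  then obtain m where m: "0 < m" "\<And>x \<xi>. x \<in> K \<Longrightarrow> m * norm \<xi> \<le> (\<Sum>i<N. \<bar>\<zeta> (u i) x \<bullet> \<xi>\<bar>)"
    using sum_abs_inner_bounded_below[of K "{..<N}" "\<lambda>i. \<zeta> (u i)"] K(1) u
    unfolding admissible_set_eq by (auto simp: Bex_def)
  \<comment> \<open>This choice gives N * e < m, strictly and also for N = 0.\<close>
  define e where "e = m / (real N + 1)"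
  have e: "0 < e" using m(1) by (simp add: e_def)
  have "\<exists>\<delta>. i < N \<longrightarrow> 0 < \<delta> \<and> (\<forall>v\<in>holder_space l \<alpha> K. holder_norm l \<alpha> K (\<lambda>y. v y - u i y) < \<delta> \<longrightarrow>
      (\<forall>x\<in>K. norm (\<zeta> v x - \<zeta> (u i) x) < e))" for i
  proof (cases "i < N")
    case True
    show ?thesis by (rule continuous_linear_holder_uniform[OF \<zeta> K uH[OF True] e]) blast
  qed simp
  from choice[OF allI, OF this] obtain \<delta> where "\<forall>i. i < N \<longrightarrow> 0 < \<delta> i \<and> (\<forall>v\<in>holder_space l \<alpha> K. holder_norm l \<alpha> K (\<lambda>y. v y - u i y) < \<delta> i \<longrightarrow>
      (\<forall>x\<in>K. norm (\<zeta> v x - \<zeta> (u i) x) < e))" ..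
  then have \<delta>: "\<And>i. i < N \<Longrightarrow> 0 < \<delta> i"
    "\<And>i v x. i < N \<Longrightarrow> v \<in> holder_space l \<alpha> K \<Longrightarrow> holder_norm l \<alpha> K (\<lambda>y. v y - u i y) < \<delta> i \<Longrightarrow>
      x \<in> K \<Longrightarrow> norm (\<zeta> v x - \<zeta> (u i) x) < e"
    by blast+
  show thesis
  proof (rule that[OF \<delta>(1)])
    fix v assume v: "v \<in> {..<N} \<rightarrow>\<^sub>E H" and close: "\<And>i. i < N \<Longrightarrow> holder_norm l \<alpha> K (\<lambda>y. v i y - u i y) < \<delta> i"
    have "\<exists>i<N. \<zeta> (v i) x \<bullet> \<xi> \<noteq> 0" if x: "x \<in> K" and \<xi>: "\<xi> \<noteq> 0" for x \<xi>
    proof (rule ccontr)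
      assume "\<not> (\<exists>i<N. \<zeta> (v i) x \<bullet> \<xi> \<noteq> 0)"
      then have zero: "\<zeta> (v i) x \<bullet> \<xi> = 0" if "i < N" for i using that by blast
      have "\<bar>\<zeta> (u i) x \<bullet> \<xi>\<bar> \<le> e * norm \<xi>" if i: "i < N" for i
      proof -
        have "v i \<in> holder_space l \<alpha> K" using v H i by (auto simp: PiE_iff)
        then have "norm (\<zeta> (v i) x - \<zeta> (u i) x) < e" using \<delta>(2) i close x by blast
        moreover have "\<bar>\<zeta> (u i) x \<bullet> \<xi>\<bar> = \<bar>(\<zeta> (v i) x - \<zeta> (u i) x) \<bullet> \<xi>\<bar>"
          using zero[OF i] by (simp add: inner_diff_left)
        ultimately show ?thesis
          using Cauchy_Schwarz_ineq2[of "\<zeta> (v i) x - \<zeta> (u i) x" \<xi>]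
            mult_right_mono[of "norm (\<zeta> (v i) x - \<zeta> (u i) x)" e "norm \<xi>"] by simp
      qed
      then have "(\<Sum>i<N. \<bar>\<zeta> (u i) x \<bullet> \<xi>\<bar>) \<le> (\<Sum>i<N. e * norm \<xi>)" by (intro sum_mono) auto
      also have "\<dots> = (real N * e) * norm \<xi>" by simp
      also have "\<dots> < m * norm \<xi>"
        using m(1) \<xi> by (intro mult_strict_right_mono) (auto simp: e_def field_simps)
      finally show False using m(2)[OF x, of \<xi>] by linarith
    qed
    then show "v \<in> admissible_set N H \<zeta> K" using v unfolding admissible_set_eq by blast
  qed
qed

theorem theorem5:
  fixes \<Omega> K :: "(real^'d) set"
    and a :: "real^'d \<Rightarrow> real^'d^'d"
    and b c :: "real^'d \<Rightarrow> real^'d"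
    and q :: "real^'d \<Rightarrow> real"
    and l :: nat and \<alpha> :: real
    and T :: "(real^'d \<Rightarrow> real) set"
    and \<zeta> :: "(real^'d \<Rightarrow> real) \<Rightarrow> real^'d \<Rightarrow> real^'n"
  assumes "CARD('d) \<ge> 2"
    and "bounded_smooth_domain \<Omega>"
    and "0 < \<alpha>" and "\<alpha> < 1"
    and "uniformly_elliptic \<Omega> a"
    and "regular_coefficients l \<alpha> \<Omega> a b c q T"
    and "smooth_compact K" and "K \<subseteq> closure \<Omega>"
    and "continuous_linear_holder l \<alpha> K \<zeta>"
    and "candidate_set (HK l \<alpha> \<Omega> a b c q K) \<zeta> K = K"
  shows "let N = nat \<lfloor>(real CARD('d) + real CARD('n)) / \<alpha>\<rfloor>;
             H = HK l \<alpha> \<Omega> a b c q K;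
             X = product_topology (\<lambda>_. HK_topology l \<alpha> \<Omega> a b c q K) {..<N};
             E = admissible_set N H \<zeta> K
         in openin X E \<and> X closure_of E = ({..<N} \<rightarrow>\<^sub>E H)"
proof -
  define N where "N = nat \<lfloor>(real CARD('d) + real CARD('n)) / \<alpha>\<rfloor>"
  define H where "H = HK l \<alpha> \<Omega> a b c q K"
  define Nm where "Nm = HK_norm l \<alpha> \<Omega> K"
  define X where "X = product_topology (\<lambda>_::nat. norm_topology H Nm) {..<N}"
  define E where "E = admissible_set N H \<zeta> K"
  have \<Omega>: "open \<Omega>" "bounded \<Omega>" using assms(2) by (auto simp: bounded_smooth_domain_def)
  have K: "compact K" "K = closure (interior K)"
    using assms(7) smooth_compact_closure_interior[of K] by (auto simp: smooth_compact_def)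
  interpret fn_seminorm H Nm
    unfolding H_def Nm_def by (rule fn_seminorm_HK[OF \<Omega> assms(6) K(1)])
  interpret H1: fn_seminorm "H1 \<Omega>" "H1_norm \<Omega>" by (rule fn_seminorm_H1[OF \<Omega>(1)])
  have H: "H \<subseteq> holder_space l \<alpha> K" by (auto simp: H_def HK_def)
  have topX: "topspace X = {..<N} \<rightarrow>\<^sub>E H" by (simp add: X_def)
  have EX: "E \<subseteq> topspace X" unfolding topX E_def admissible_set_def by blast
  \<comment> \<open>Since the H^1 part is nonnegative, balls in H(K) lie in Hoelder balls of the
    same radius, where continuity of \<zeta> applies.\<close>
  have holder_le: "holder_norm l \<alpha> K u \<le> Nm u" if "u \<in> H" for u
    using H1.nonneg[of u] that by (simp add: Nm_def HK_norm_def H_def HK_def)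
  have N: "real CARD('d) / \<alpha> + real (CARD('n) - 1) < real N"
  proof -
    \<comment> \<open>Rounding down loses less than 1, which is exactly the dimension saved by
      normalising \<xi>; \<alpha> < 1 then gives n \<le> n/\<alpha>.\<close>
    have "(real CARD('d) + real CARD('n)) / \<alpha> < real N + 1"
      unfolding N_def by linarith
    moreover have "real CARD('n) \<le> real CARD('n) / \<alpha>"
      using assms(3,4) by (simp add: field_simps)
    moreover have "real (CARD('n) - 1) = real CARD('n) - 1"
      by (simp add: of_nat_diff Suc_leI)
    ultimately show ?thesis by (simp add: add_divide_distrib)
  qed
  have "openin X E"
  proof (subst openin_subopen, intro ballI)
    fix u assume u: "u \<in> E"
    then have uH: "u i \<in> H" if "i < N" for i using EX that by (auto simp: topX PiE_iff)
    obtain \<delta> where \<delta>: "\<And>i. i < N \<Longrightarrow> 0 < \<delta> i"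
      "\<And>v. v \<in> {..<N} \<rightarrow>\<^sub>E H \<Longrightarrow> (\<And>i. i < N \<Longrightarrow> holder_norm l \<alpha> K (\<lambda>y. v i y - u i y) < \<delta> i) \<Longrightarrow> v \<in> E"
      using admissible_set_stable[OF K assms(9) H u[unfolded E_def]] unfolding E_def by blast
    define B where "B = (\<Pi>\<^sub>E i\<in>{..<N}. {v\<in>H. Nm (\<lambda>y. v y - u i y) < \<delta> i})"
    have "openin X B"
      unfolding X_def B_def using openin_ball uH \<delta>(1) by (subst openin_PiE) auto
    moreover have "u \<in> B"
      unfolding B_def
    proof (rule PiE_I)
      show "u i \<in> {v\<in>H. Nm (\<lambda>y. v y - u i y) < \<delta> i}" if "i \<in> {..<N}" for i
        using center_mem_ball[OF uH \<delta>(1)] that by blast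
      show "u i = undefined" if "i \<notin> {..<N}" for i
        using u EX that unfolding topX by (auto simp: PiE_iff extensional_def)
    qed
    moreover have "B \<subseteq> E"
    proof
      fix v assume v: "v \<in> B"
      show "v \<in> E"
      proof (rule \<delta>(2))
        show "v \<in> {..<N} \<rightarrow>\<^sub>E H" using v by (auto simp: B_def PiE_iff)
        fix i assume i: "i < N"
        then have "v i \<in> H" "Nm (\<lambda>y. v i y - u i y) < \<delta> i" using v by (auto simp: B_def PiE_iff)
        then show "holder_norm l \<alpha> K (\<lambda>y. v i y - u i y) < \<delta> i"
          using holder_le[OF diff_mem[OF _ uH[OF i]], of "v i"] by linarith
      qed
    qed
    ultimately show "\<exists>B. openin X B \<and> u \<in> B \<and> B \<subseteq> E" by blast
  qed
  moreover have "topspace X \<subseteq> X closure_of E"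
  proof
    fix u assume u: "u \<in> topspace X"
    then have uH: "u i \<in> H" if "i < N" for i using that by (auto simp: topX PiE_iff)
    obtain F where F: "F \<subseteq> H" "finite F"
      "\<And>u \<epsilon>. u \<in> {..<N} \<rightarrow> H \<Longrightarrow> 0 < \<epsilon> \<Longrightarrow> \<exists>t. (\<forall>i<N. \<forall>f\<in>F. \<bar>t i f\<bar> \<le> \<epsilon>) \<and>
        (\<forall>x\<in>K. \<forall>\<xi>. \<xi> \<noteq> 0 \<longrightarrow> (\<exists>i<N. \<zeta> (\<lambda>y. u i y + (\<Sum>f\<in>F. t i f *\<^sub>R f y)) x \<bullet> \<xi> \<noteq> 0))"
      using admissible_set_perturbation[OF K assms(3) less_imp_le[OF assms(4)] assms(9) H assms(10)[folded H_def] N]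
      by blast
    have "\<exists>v\<in>E. v \<in> W" if "u \<in> W" "openin X W" for W
    proof -
      have "\<exists>U. (\<forall>i\<in>{..<N}. openin (norm_topology H Nm) (U i)) \<and> u \<in> Pi\<^sub>E {..<N} U \<and> Pi\<^sub>E {..<N} U \<subseteq> W"
        using that unfolding X_def openin_product_topology_alt by blast
      then obtain U where U: "\<And>i. i < N \<Longrightarrow> openin (norm_topology H Nm) (U i)" "u \<in> Pi\<^sub>E {..<N} U" "Pi\<^sub>E {..<N} U \<subseteq> W"
        by blast
      have "\<exists>r. i < N \<longrightarrow> 0 < r \<and> {v\<in>H. Nm (\<lambda>x. v x - u i x) < r} \<subseteq> U i" for i
      proof (cases "i < N")
        case True
        then have "u i \<in> U i" using U(2) by (auto simp: PiE_iff)
        from openin_contains_ball[OF U(1)[OF True] this] show ?thesis by blast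
      qed simp
      from choice[OF allI, OF this] obtain r where "\<forall>i. i < N \<longrightarrow> 0 < r i \<and> {v\<in>H. Nm (\<lambda>x. v x - u i x) < r i} \<subseteq> U i" ..
      then have r: "\<And>i. i < N \<Longrightarrow> 0 < r i" "\<And>i. i < N \<Longrightarrow> {v\<in>H. Nm (\<lambda>x. v x - u i x) < r i} \<subseteq> U i"
        by blast+
      \<comment> \<open>A common radius for all rows; the inserted 1 keeps the set nonempty for
        every N.\<close>
      define \<delta> where "\<delta> = Min (insert 1 (r ` {..<N}))"
      have \<delta>: "0 < \<delta>" "\<And>i. i < N \<Longrightarrow> \<delta> \<le> r i" using r(1) by (auto simp: \<delta>_def)
      define s where "s = (\<Sum>f\<in>F. Nm f)"
      have s: "0 \<le> s" unfolding s_def using F(1) nonneg by (intro sum_nonneg) auto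
      \<comment> \<open>Each perturbation has norm at most \<epsilon> * s, which stays below
        \<delta>; the added 1 covers s = 0.\<close>
      define \<epsilon> where "\<epsilon> = \<delta> / (s + 1)"
      have \<epsilon>: "0 < \<epsilon>" "\<epsilon> * s < \<delta>" using \<delta> s by (auto simp: \<epsilon>_def field_simps)
      have "u \<in> {..<N} \<rightarrow> H" using uH by auto
      from F(3)[OF this \<epsilon>(1)] obtain t where t: "\<And>i f. i < N \<Longrightarrow> f \<in> F \<Longrightarrow> \<bar>t i f\<bar> \<le> \<epsilon>"
        "\<And>x \<xi>. x \<in> K \<Longrightarrow> \<xi> \<noteq> 0 \<Longrightarrow> \<exists>i<N. \<zeta> (\<lambda>y. u i y + (\<Sum>f\<in>F. t i f *\<^sub>R f y)) x \<bullet> \<xi> \<noteq> 0"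
        by blast
      define p where "p i y = (\<Sum>f\<in>F. t i f *\<^sub>R f y)" for i and y :: "real^'d"
      define v where "v = restrict (\<lambda>i y. u i y + p i y) {..<N}"
      have p: "p i \<in> H" "Nm (p i) < r i" if i: "i < N" for i
      proof -
        show "p i \<in> H" unfolding p_def using sum_mem_le[OF uH[OF i] F(2,1)] by blast
        have "Nm (p i) \<le> (\<Sum>f\<in>F. \<bar>t i f\<bar> * Nm f)"
          unfolding p_def using sum_mem_le[OF uH[OF i] F(2,1)] by blast
        also have "\<dots> \<le> (\<Sum>f\<in>F. \<epsilon> * Nm f)"
          using t(1)[OF i] nonneg F(1) by (intro sum_mono mult_right_mono) auto
        also have "\<dots> = \<epsilon> * s" by (simp add: s_def sum_distrib_left)
        finally show "Nm (p i) < r i" using \<epsilon>(2) \<delta>(2)[OF i] by linarith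
      qed
      have vH: "(\<lambda>y. u i y + p i y) \<in> H" if "i < N" for i
        using lincomb_mem[OF uH[OF that] p(1)[OF that], of 1 1] by simp
      have "v \<in> Pi\<^sub>E {..<N} U"
      proof
        fix i assume i: "i \<in> {..<N}"
        then have "v i \<in> {v\<in>H. Nm (\<lambda>x. v x - u i x) < r i}"
          using vH p(2) by (simp add: v_def)
        then show "v i \<in> U i" using r(2) i by blast
      qed (simp add: v_def)
      moreover have "v \<in> E"
        unfolding E_def admissible_set_eq
      proof (intro CollectI conjI ballI allI impI)
        show "v \<in> {..<N} \<rightarrow>\<^sub>E H" using vH by (auto simp: v_def)
        fix x \<xi> assume "x \<in> K" "\<xi> \<noteq> (0 :: real^'n)"
        from t(2)[OF this] show "\<exists>i<N. \<zeta> (v i) x \<bullet> \<xi> \<noteq> 0"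
          by (auto simp: v_def p_def)
      qed
      ultimately show ?thesis using U(3) by blast
    qed
    then show "u \<in> X closure_of E" using u unfolding in_closure_of by blast
  qed
  then have "X closure_of E = ({..<N} \<rightarrow>\<^sub>E H)"
    using closure_of_subset_topspace[of X E] topX by blast
  ultimately show ?thesis
    unfolding Let_def HK_topology_def N_def[symmetric] H_def[symmetric] Nm_def[symmetric]
      X_def[symmetric] E_def[symmetric] by blast
qed

end
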